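(* Let $d\in\mathbb{N}$, let $W\subset\mathbb{R}^d$ be a non-empty bounded open set and let $\Phi_1,\Phi_2,\ldots$ be independent and identically distributed point processes on $\mathbb{R}^d$ observed in $W$, with well-defined intensity function $\lambda$ and pair correlation function $g$. Suppose that $g:W\times W\to\mathbb{R}$ is bounded and that $\lambda:W\to(\underline\lambda,\bar\lambda)$, with $0<\underline\lambda<\bar\lambda<\infty$, is bounded, bounded away from zero and twice continuously differentiable on $W$ with bounded second order partial derivatives $\lambda_{ij}=D_{ij}\lambda$, $i,j=1,\dots,d$. Let $\gamma>2$ and let $(h_n)_{n\in\mathbb{N}}$ be a sequence of positive bandwidths with $h_n\to0$ and $nh_n^d\to\infty$ as $n\to\infty$. For $x_0\in W$ consider the adaptive estimator \[ \tilde\lambda(x_0)=\frac1n\sum_{i=1}^n\sum_{y\in\Phi_i\cap W}\frac{c(y)^d}{h_n^d}\,\kappa^\gamma\Big(\frac{x_0-y}{h_n}\,c(y)\Big),\qquad c(x)=\sqrt{\frac{\lambda(x)}{\lambda(x_0)}},\quad x\in W, \] where $\kappa^\gamma$ is the Beta kernel. Then, for $x_0\in W$, as $n\to\infty$, 1. $\displaystyle\mathrm{bias}\,\tilde\lambda(x_0)=o(h_n^2)$; 2. $\displaystyle\mathrm{Var}\,\tilde\lambda(x_0)=\frac{\lambda(x_0)Q(d,\gamma)}{nh_n^d}+O\Big(\frac{1}{nh_n^{d-1}}\Big)$.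
   Context: Point processes: the factorial moment measures of $\Phi_1$ of first and second order exist (as locally finite measures) and, on $W$ and $W\times W$ respectively, are absolutely continuous with respect to Lebesgue measure with densities $\lambda$ (the intensity function) and $\rho^{(2)}$ (the second order product density). That is, $\mathbb{E}\sum_{y\in\Phi_1\cap W}f(y)=\int_W f\lambda\,du$ and $\mathbb{E}\sum_{y\ne z\in\Phi_1\cap W}f(y,z)=\int_{W^2}f\rho^{(2)}\,du\,dv$ for non-negative measurable $f$. The pair correlation function is $g(u,v)=\rho^{(2)}(u,v)/(\lambda(u)\lambda(v))$ for $u,v\in W$. Beta kernel: for $\gamma\ge0$, $\kappa^\gamma(x)=c(d,\gamma)^{-1}(1-x^Tx)^\gamma\,1\{x\in b(0,1)\}$, $x\in\mathbb{R}^d$, where $b(0,1)$ is the closed unit ball of $\mathbb{R}^d$ centred at the origin and $c(d,\gamma)=\int_{b(0,1)}(1-x^Tx)^\gamma dx=\pi^{d/2}\Gamma(\gamma+1)/\Gamma(d/2+\gamma+1)$ (a normalising constant, not to be confused with the weight function $c(\cdot)$). Constant: $Q(d,\gamma)=\int_{\mathbb{R}^d}\kappa^\gamma(x)^2dx=c(d,2\gamma)/c(d,\gamma)^2$. The bias is $\mathrm{bias}\,\tilde\lambda(x_0)=\mathbb{E}\,\tilde\lambda(x_0)-\lambda(x_0)$. $D_{ij}$ denotes second order partial derivatives. *)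

theory Defs
  imports "HOL-Probability.Probability" "HOL-Library.Landau_Symbols"
begin

section \<open>Point processes\<close>

definition locally_finite_config :: "'a::metric_space set \<Rightarrow> bool" where
  "locally_finite_config \<phi> \<longleftrightarrow> (\<forall>B. bounded B \<longrightarrow> finite (\<phi> \<inter> B))"

text \<open>The space of locally finite configurations, with the \<open>\<sigma>\<close>-algebra generated by the
  counts \<open>\<phi> \<mapsto> card (\<phi> \<inter> B)\<close> over bounded Borel sets \<open>B\<close>.\<close>

definition config_space :: "'a::euclidean_space set measure" where
  "config_space = sigma {\<phi>. locally_finite_config \<phi>}
     {{\<phi>. locally_finite_config \<phi> \<and> card (\<phi> \<inter> B) = k} | B k. B \<in> sets borel \<and> bounded B}"

definition iid_point_processes ::
    "'w measure \<Rightarrow> (nat \<Rightarrow> 'w \<Rightarrow> 'a::euclidean_space set) \<Rightarrow> bool" where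
  "iid_point_processes M \<Phi> \<longleftrightarrow>
     (\<forall>i\<ge>1. \<Phi> i \<in> M \<rightarrow>\<^sub>M config_space) \<and>
     prob_space.indep_vars M (\<lambda>_. config_space) \<Phi> {1..} \<and>
     (\<forall>i\<ge>1. distr M config_space (\<Phi> i) = distr M config_space (\<Phi> 1))"

text \<open>The integrals of \<open>f\<close> with respect to the first and second order factorial moment measures:
  the expectations of the sums of \<open>f\<close> over the points, respectively over the ordered pairs of
  distinct points. The moment measure of a set is obtained with \<open>f = indicator A\<close>.\<close>

definition factorial_moment1 ::
    "'w measure \<Rightarrow> ('w \<Rightarrow> 'a set) \<Rightarrow> ('a \<Rightarrow> ennreal) \<Rightarrow> ennreal" where
  "factorial_moment1 M X f = (\<integral>\<^sup>+\<omega>. (\<integral>\<^sup>+y. f y \<partial>count_space (X \<omega>)) \<partial>M)"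

definition factorial_moment2 ::
    "'w measure \<Rightarrow> ('w \<Rightarrow> 'a set) \<Rightarrow> ('a \<times> 'a \<Rightarrow> ennreal) \<Rightarrow> ennreal" where
  "factorial_moment2 M X f =
     (\<integral>\<^sup>+\<omega>. (\<integral>\<^sup>+p. f p \<partial>count_space {(y, z). y \<in> X \<omega> \<and> z \<in> X \<omega> \<and> y \<noteq> z}) \<partial>M)"

definition locally_finite_moments :: "'w measure \<Rightarrow> ('w \<Rightarrow> 'a::euclidean_space set) \<Rightarrow> bool" where
  "locally_finite_moments M X \<longleftrightarrow>
     (\<forall>A\<in>sets borel. bounded A \<longrightarrow> factorial_moment1 M X (indicator A) < \<infinity>) \<and>
     (\<forall>A\<in>sets borel. bounded A \<longrightarrow> factorial_moment2 M X (indicator A) < \<infinity>)"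

definition is_intensity ::
    "'w measure \<Rightarrow> ('w \<Rightarrow> 'a::euclidean_space set) \<Rightarrow> 'a set \<Rightarrow> ('a \<Rightarrow> real) \<Rightarrow> bool" where
  "is_intensity M X W lam \<longleftrightarrow>
     set_borel_measurable borel W lam \<and> (\<forall>u\<in>W. 0 \<le> lam u) \<and>
     (\<forall>f\<in>borel_measurable borel.
        factorial_moment1 M (\<lambda>\<omega>. X \<omega> \<inter> W) f = (\<integral>\<^sup>+u\<in>W. f u * ennreal (lam u) \<partial>lborel))"

definition is_product_density2 ::
    "'w measure \<Rightarrow> ('w \<Rightarrow> 'a::euclidean_space set) \<Rightarrow> 'a set \<Rightarrow> ('a \<times> 'a \<Rightarrow> real) \<Rightarrow> bool" where
  "is_product_density2 M X W \<rho> \<longleftrightarrow>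
     set_borel_measurable borel (W \<times> W) \<rho> \<and> (\<forall>p\<in>W \<times> W. 0 \<le> \<rho> p) \<and>
     (\<forall>f\<in>borel_measurable borel.
        factorial_moment2 M (\<lambda>\<omega>. X \<omega> \<inter> W) f = (\<integral>\<^sup>+p\<in>W \<times> W. f p * ennreal (\<rho> p) \<partial>lborel))"

definition pair_correlation :: "('a \<Rightarrow> real) \<Rightarrow> ('a \<times> 'a \<Rightarrow> real) \<Rightarrow> 'a \<Rightarrow> 'a \<Rightarrow> real" where
  "pair_correlation lam \<rho> u v = \<rho> (u, v) / (lam u * lam v)"

section \<open>Differentiability\<close>

definition partial_deriv :: "'n::finite \<Rightarrow> (real ^ 'n \<Rightarrow> real) \<Rightarrow> real ^ 'n \<Rightarrow> real" where
  "partial_deriv i f x = deriv (\<lambda>t. f (x + t *\<^sub>R axis i 1)) 0"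

definition C1_on :: "(real ^ 'n::finite) set \<Rightarrow> (real ^ 'n \<Rightarrow> real) \<Rightarrow> bool" where
  "C1_on W f \<longleftrightarrow> f differentiable_on W \<and> (\<forall>i. continuous_on W (partial_deriv i f))"

definition C2_on :: "(real ^ 'n::finite) set \<Rightarrow> (real ^ 'n \<Rightarrow> real) \<Rightarrow> bool" where
  "C2_on W f \<longleftrightarrow> C1_on W f \<and> (\<forall>i. C1_on W (partial_deriv i f))"

section \<open>The kernel estimator\<close>

definition beta_const :: "'n::finite itself \<Rightarrow> real \<Rightarrow> real" where
  "beta_const _ \<gamma> = (LINT x:cball (0 :: real ^ 'n) 1|lborel. (1 - x \<bullet> x) powr \<gamma>)"

text \<open>Since \<open>0 powr 0 = 0\<close>, for \<open>\<gamma> = 0\<close> this vanishes on the unit sphere; for \<open>\<gamma> > 0\<close>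
  it is the Beta kernel everywhere.\<close>

definition beta_kernel :: "real \<Rightarrow> real ^ 'n::finite \<Rightarrow> real" where
  "beta_kernel \<gamma> x =
     inverse (beta_const TYPE('n) \<gamma>) * (1 - x \<bullet> x) powr \<gamma> * indicator (cball 0 1) x"

definition beta_Q :: "'n::finite itself \<Rightarrow> real \<Rightarrow> real" where
  "beta_Q _ \<gamma> = (LINT x|lborel. (beta_kernel \<gamma> (x :: real ^ 'n))\<^sup>2)"

definition abramson_weight :: "('a \<Rightarrow> real) \<Rightarrow> 'a \<Rightarrow> 'a \<Rightarrow> real" where
  "abramson_weight lam x0 x = sqrt (lam x / lam x0)"

definition adaptive_estimator ::
    "(nat \<Rightarrow> 'w \<Rightarrow> (real ^ 'n::finite) set) \<Rightarrow> (real ^ 'n) set \<Rightarrow> (real ^ 'n \<Rightarrow> real) \<Rightarrow>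
     real \<Rightarrow> (nat \<Rightarrow> real) \<Rightarrow> real ^ 'n \<Rightarrow> nat \<Rightarrow> 'w \<Rightarrow> real" where
  "adaptive_estimator \<Phi> W lam \<gamma> h x0 n \<omega> =
     1 / real n * (\<Sum>i=1..n. \<Sum>y\<in>\<Phi> i \<omega> \<inter> W.
       abramson_weight lam x0 y ^ CARD('n) / h n ^ CARD('n) *
       beta_kernel \<gamma> (abramson_weight lam x0 y *\<^sub>R ((x0 - y) /\<^sub>R h n)))"

definition bias :: "'w measure \<Rightarrow> ('w \<Rightarrow> real) \<Rightarrow> real \<Rightarrow> real" where
  "bias M X \<theta> = prob_space.expectation M X - \<theta>"

end

theory Submission imports Defs begin

text \<open>
  Why the statement holds. Write \<open>t(u) = \<lambda>(x0 + h u) / \<lambda>(x0)\<close>, so that the weight at \<open>x0 + h u\<close> is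
  \<open>sqrt (t(u))\<close>. By Campbell's formula and the substitution \<open>y = x0 + h u\<close>, the mean of the
  estimator is \<open>\<lambda>(x0) / K\<close> times the integral of \<open>\<psi>(t(u), u)\<close>, where \<open>K\<close> normalises the kernel and
  \<open>\<psi>(t, u) = t powr (d/2 + 1) * max 0 (1 - t |u|^2) powr \<gamma>\<close>. For \<open>t = 1\<close> this integral is \<open>K\<close>.

  Bias. As \<open>\<lambda>\<close> is twice continuously differentiable, \<open>t(u) = 1 + h L(u) + h^2 q(u) + o(h^2)\<close> with \<open>L\<close>
  linear and \<open>q\<close> quadratic; as \<open>\<gamma> > 2\<close>, \<open>\<psi>\<close> is twice continuously differentiable in \<open>t\<close>, also where
  \<open>t |u|^2 = 1\<close>. Hence the bias has an expansion whose term in \<open>h\<close> is the integral of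
  \<open>\<psi>'(1, u) L(u)\<close>, zero by oddness, and whose term in \<open>h^2\<close> is the integral of
  \<open>\<psi>'(1, u) q(u) + \<psi>''(1, u) L(u)^2 / 2\<close>. The latter vanishes for the following reason, which is what
  the square-root weights are made for: against a form homogeneous of degree two, such as \<open>q\<close> or
  \<open>L^2\<close>, the integral of \<open>\<psi>(t, u)\<close> does not depend on \<open>t\<close>, because replacing \<open>u\<close> by
  \<open>sqrt t * u\<close> absorbs exactly the factor \<open>t powr (d/2 + 1)\<close>; so its first two \<open>t\<close>-derivatives are zero
  (\<open>profile_moment_scaling\<close>, \<open>profile_moment_derivatives_vanish\<close>). Both second order bounds are uniform
  on the common compact support, so dominated convergence turns the pointwise expansion into the
  claim (\<open>abramson_cancellation\<close>).

  Variance. By independence it is \<open>1/n\<close> times the variance of the sum over one process. The diagonal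
  part of the second moment is the integral of the squared summand against \<open>\<lambda>\<close>, which the same
  substitution turns into \<open>h^(-d)\<close> times an integral differing by \<open>O(h)\<close> from \<open>\<lambda>(x0) Q\<close>. What remains
  is the integral of \<open>g - 1\<close> against the product of two summands weighted with \<open>\<lambda>\<close>; as \<open>g\<close> is bounded,
  it is at most a multiple of the squared mean, hence \<open>O(1)\<close> (\<open>linear_statistic_moments\<close>).
\<close>

section \<open>Second order expansions in one variable and the dilated kernel profile\<close>

lemma taylor_second_order:
  fixes f f' f'' :: "real \<Rightarrow> real"
  assumes f: "\<And>s. a \<le> s \<Longrightarrow> s \<le> b \<Longrightarrow> (f has_real_derivative f' s) (at s)"
    and f': "\<And>s. a \<le> s \<Longrightarrow> s \<le> b \<Longrightarrow> (f' has_real_derivative f'' s) (at s)"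
    and "a \<le> c" "c \<le> b" "a \<le> x" "x \<le> b"
  obtains \<xi> where "a \<le> \<xi>" "\<xi> \<le> b" "\<bar>\<xi> - c\<bar> \<le> \<bar>x - c\<bar>"
    "f x = f c + f' c * (x - c) + f'' \<xi> / 2 * (x - c)\<^sup>2"
proof (cases "x = c")
  case True
  with assms that[of c] show ?thesis by simp
next
  case False
  define diff where "diff = (\<lambda>m::nat. if m = 0 then f else if m = 1 then f' else f'')"
  have "\<exists>t. (if x < c then x < t \<and> t < c else c < t \<and> t < x) \<and>
      f x = (\<Sum>m<2. diff m c / fact m * (x - c)^m) + diff 2 t / fact 2 * (x - c)^2"
  proof (rule Taylor)
    show "\<forall>m t. m < 2 \<and> a \<le> t \<and> t \<le> b \<longrightarrow> (diff m has_real_derivative diff (Suc m) t) (at t)"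
      using f f' by (auto simp: diff_def less_2_cases_iff)
  qed (use assms False in \<open>auto simp: diff_def\<close>)
  then obtain t where t: "if x < c then x < t \<and> t < c else c < t \<and> t < x"
    and eq: "f x = (\<Sum>m<2. diff m c / fact m * (x - c)^m) + diff 2 t / fact 2 * (x - c)^2"
    by blast
  have "f x = f c + f' c * (x - c) + f'' t / 2 * (x - c)\<^sup>2"
    using eq by (simp add: diff_def numeral_2_eq_2)
  with that[of t] t assms(3-) show ?thesis
    by (auto split: if_splits)
qed

text \<open>
  Chain rule for second order expansions along a sequence. The inner expansion is only assumed as a
  limit, so that it can be applied for each fixed \<open>u\<close> to the relative intensity at \<open>x0 + h u\<close>.
\<close>

lemma second_order_chain_limit:
  fixes f f' f'' :: "real \<Rightarrow> real" and t h :: "nat \<Rightarrow> real"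
  assumes f: "\<And>s. a \<le> s \<Longrightarrow> s \<le> b \<Longrightarrow> (f has_real_derivative f' s) (at s)"
    and f': "\<And>s. a \<le> s \<Longrightarrow> s \<le> b \<Longrightarrow> (f' has_real_derivative f'' s) (at s)"
    and cont: "isCont f'' c" and c: "a \<le> c" "c \<le> b"
    and t: "\<forall>\<^sub>F n in sequentially. a \<le> t n \<and> t n \<le> b"
    and h: "h \<longlonglongrightarrow> 0" "\<forall>\<^sub>F n in sequentially. h n > 0"
    and q: "(\<lambda>n. (t n - c - h n * l) / (h n)\<^sup>2) \<longlonglongrightarrow> q"
  shows "(\<lambda>n. (f (t n) - f c - h n * f' c * l) / (h n)\<^sup>2) \<longlonglongrightarrow> f' c * q + f'' c / 2 * l\<^sup>2"
proof -
  have "(\<lambda>n. h n * ((t n - c - h n * l) / (h n)\<^sup>2) + l) \<longlonglongrightarrow> 0 * q + l"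
    by (intro tendsto_intros q h)
  moreover have "\<forall>\<^sub>F n in sequentially. h n * ((t n - c - h n * l) / (h n)\<^sup>2) + l = (t n - c) / h n"
    using h(2) by eventually_elim (simp add: field_simps power2_eq_square)
  ultimately have l: "(\<lambda>n. (t n - c) / h n) \<longlonglongrightarrow> l"
    by (simp add: tendsto_cong)
  have "(\<lambda>n. h n * ((t n - c) / h n)) \<longlonglongrightarrow> 0 * l"
    by (intro tendsto_intros l h)
  moreover have "\<forall>\<^sub>F n in sequentially. h n * ((t n - c) / h n) = t n - c"
    using h(2) by eventually_elim simp
  ultimately have "(\<lambda>n. t n - c) \<longlonglongrightarrow> 0"
    by (simp add: tendsto_cong)
  have ex: "\<exists>\<xi>. a \<le> t n \<and> t n \<le> b \<longrightarrow> \<bar>\<xi> - c\<bar> \<le> \<bar>t n - c\<bar> \<and>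
      f (t n) = f c + f' c * (t n - c) + f'' \<xi> / 2 * (t n - c)\<^sup>2" for n
    using taylor_second_order[of a b f f' f'' c "t n"] f f' c by metis
  then obtain \<xi> where \<xi>: "\<And>n. a \<le> t n \<and> t n \<le> b \<Longrightarrow> \<bar>\<xi> n - c\<bar> \<le> \<bar>t n - c\<bar> \<and>
      f (t n) = f c + f' c * (t n - c) + f'' (\<xi> n) / 2 * (t n - c)\<^sup>2"
    by metis
  have "(\<lambda>n. \<xi> n - c) \<longlonglongrightarrow> 0"
    by (rule Lim_null_comparison[OF _ tendsto_rabs_zero[OF \<open>(\<lambda>n. t n - c) \<longlonglongrightarrow> 0\<close>]])
      (use t in eventually_elim, use \<xi> in auto)
  hence "\<xi> \<longlonglongrightarrow> c" by (simp add: LIM_zero_iff)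
  hence "(\<lambda>n. f'' (\<xi> n)) \<longlonglongrightarrow> f'' c"
    using cont by (rule isCont_tendsto_compose[rotated])
  hence "(\<lambda>n. f' c * ((t n - c - h n * l) / (h n)\<^sup>2) + f'' (\<xi> n) / 2 * ((t n - c) / h n)\<^sup>2)
      \<longlonglongrightarrow> f' c * q + f'' c / 2 * l\<^sup>2"
    by (intro tendsto_intros q l) simp_all
  moreover have "\<forall>\<^sub>F n in sequentially.
      f' c * ((t n - c - h n * l) / (h n)\<^sup>2) + f'' (\<xi> n) / 2 * ((t n - c) / h n)\<^sup>2
      = (f (t n) - f c - h n * f' c * l) / (h n)\<^sup>2"
    using t h(2)
  proof eventually_elim
    case (elim n)
    from \<xi>[OF elim(1)] have "f (t n) = f c + f' c * (t n - c) + f'' (\<xi> n) / 2 * (t n - c)\<^sup>2"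
      by simp
    thus ?case using elim(2) by (simp add: power_divide) (simp add: field_simps)
  qed
  ultimately show ?thesis by (rule Lim_transform_eventually)
qed

text \<open>
  The radial kernel shape at a point with squared norm \<open>w\<close>, dilated by \<open>sqrt t\<close>. The free exponent
  \<open>p\<close> collects the powers of the weight and of the intensity, and it makes the family closed under
  differentiation in \<open>t\<close>: \<open>profile'\<close> and \<open>profile''\<close> are the derivatives in \<open>t\<close>. Cutting off with
  \<open>max\<close> and using \<open>0 powr \<gamma> = 0\<close> also covers points outside the unit ball.
\<close>

definition profile :: "real \<Rightarrow> real \<Rightarrow> real \<Rightarrow> real \<Rightarrow> real" where
  "profile p \<gamma> w t = t powr p * (max 0 (1 - t * w)) powr \<gamma>"

definition profile' :: "real \<Rightarrow> real \<Rightarrow> real \<Rightarrow> real \<Rightarrow> real" where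
  "profile' p \<gamma> w t = p * profile (p - 1) \<gamma> w t - \<gamma> * w * profile p (\<gamma> - 1) w t"

definition profile'' :: "real \<Rightarrow> real \<Rightarrow> real \<Rightarrow> real \<Rightarrow> real" where
  "profile'' p \<gamma> w t = p * profile' (p - 1) \<gamma> w t - \<gamma> * w * profile' p (\<gamma> - 1) w t"

text \<open>
  Across \<open>0\<close> the function is differentiable because \<open>y powr \<gamma> / y\<close> tends to \<open>0\<close> for \<open>\<gamma> > 1\<close>. Two
  differentiations therefore cost the hypothesis \<open>\<gamma> > 2\<close>.
\<close>

lemma DERIV_max0_powr:
  assumes "\<gamma> > 1"
  shows "((\<lambda>x::real. max 0 x powr \<gamma>) has_real_derivative \<gamma> * max 0 x powr (\<gamma> - 1)) (at x)"
proof -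
  consider "x > 0" | "x < 0" | "x = 0" by linarith
  thus ?thesis
  proof cases
    case 1
    have "((\<lambda>x. x powr \<gamma>) has_real_derivative \<gamma> * x powr (\<gamma> - 1)) (at x)"
      using 1 by (rule has_real_derivative_powr)
    hence "((\<lambda>x. max 0 x powr \<gamma>) has_real_derivative \<gamma> * x powr (\<gamma> - 1)) (at x)"
      by (rule has_field_derivative_transform_within_open[of _ _ _ "{0<..}"]) (use 1 in auto)
    thus ?thesis using 1 by (simp add: max_def)
  next
    case 2
    have "((\<lambda>x. 0) has_real_derivative 0) (at x)" by simp
    hence "((\<lambda>x. max 0 x powr \<gamma>) has_real_derivative 0) (at x)"
      by (rule has_field_derivative_transform_within_open[of _ _ _ "{..<0}"]) (use 2 in auto)
    thus ?thesis using 2 by (simp add: max_def)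
  next
    case 3
    have "((\<lambda>y::real. \<bar>y\<bar> powr (\<gamma> - 1)) \<longlongrightarrow> 0 powr (\<gamma> - 1)) (at 0)"
      by (rule tendsto_powr') (use assms in \<open>auto intro!: tendsto_eq_intros\<close>)
    hence "((\<lambda>y::real. \<bar>y\<bar> powr (\<gamma> - 1)) \<longlongrightarrow> 0) (at 0)" by simp
    hence "((\<lambda>y::real. max 0 y powr \<gamma> / y) \<longlongrightarrow> 0) (at 0)"
    proof (rule Lim_null_comparison[rotated])
      show "\<forall>\<^sub>F y::real in at 0. norm (max 0 y powr \<gamma> / y) \<le> \<bar>y\<bar> powr (\<gamma> - 1)"
        by (rule always_eventually) (auto simp: max_def powr_diff divide_nonneg_neg)
    qed
    thus ?thesis using 3 by (simp add: has_field_derivative_iff)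
  qed
qed

lemma profile_DERIV:
  assumes "t > 0" "\<gamma> > 1"
  shows "(profile p \<gamma> w has_real_derivative profile' p \<gamma> w t) (at t)"
proof -
  have 1: "((\<lambda>t. t powr p) has_real_derivative p * t powr (p - 1)) (at t)"
    using assms(1) by (rule has_real_derivative_powr)
  have "((\<lambda>t. 1 - t * w) has_real_derivative - w) (at t)"
    by (auto intro!: derivative_eq_intros)
  from DERIV_chain2[OF DERIV_max0_powr[OF assms(2)] this]
  have "((\<lambda>t. max 0 (1 - t * w) powr \<gamma>) has_real_derivative
      \<gamma> * max 0 (1 - t * w) powr (\<gamma> - 1) * - w) (at t)" .
  from DERIV_mult[OF 1 this] show ?thesis
    unfolding profile_def[abs_def] profile'_def by (simp add: algebra_simps)
qed

lemma profile'_DERIV: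
  assumes "t > 0" "\<gamma> > 2"
  shows "(profile' p \<gamma> w has_real_derivative profile'' p \<gamma> w t) (at t)"
proof -
  have eq: "profile' p \<gamma> w = (\<lambda>t. p * profile (p - 1) \<gamma> w t - \<gamma> * w * profile p (\<gamma> - 1) w t)"
    by (simp add: profile'_def fun_eq_iff)
  show ?thesis unfolding eq profile''_def
    by (intro DERIV_diff DERIV_cmult profile_DERIV) (use assms in auto)
qed

lemma isCont_profile:
  assumes "t > 0" "\<gamma> > 0"
  shows "isCont (profile p \<gamma> w) t"
  unfolding profile_def[abs_def] isCont_def
  by (intro tendsto_intros) (use assms in auto)

lemma isCont_profile'':
  assumes "t > 0" "\<gamma> > 2"
  shows "isCont (profile'' p \<gamma> w) t"
  unfolding profile''_def[abs_def] profile'_def[abs_def]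
  by (intro continuous_intros isCont_profile) (use assms in auto)

lemma profile_zero: "profile p \<gamma> w 0 = 0"
  by (simp add: profile_def)

lemma profile_outside: "t * w \<ge> 1 \<Longrightarrow> profile p \<gamma> w t = 0"
  by (simp add: profile_def)

lemma profile'_outside: "t * w \<ge> 1 \<Longrightarrow> profile' p \<gamma> w t = 0"
  by (simp add: profile'_def profile_outside)

lemma profile''_outside: "t * w \<ge> 1 \<Longrightarrow> profile'' p \<gamma> w t = 0"
  by (simp add: profile''_def profile'_outside)

lemma profile_bound:
  assumes "0 < a" "a \<le> b" "\<gamma> > 0"
  shows "\<exists>C>0. \<forall>t w. a \<le> t \<longrightarrow> t \<le> b \<longrightarrow> 0 \<le> w \<longrightarrow> \<bar>profile p \<gamma> w t\<bar> \<le> C"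
proof -
  have "continuous_on {a..b} (\<lambda>t. t powr p)"
    by (intro continuous_intros) (use assms in auto)
  hence "bounded ((\<lambda>t. t powr p) ` {a..b})"
    using compact_Icc compact_continuous_image compact_imp_bounded by blast
  then obtain C where C: "C > 0" "\<And>t. t \<in> {a..b} \<Longrightarrow> \<bar>t powr p\<bar> \<le> C"
    by (auto simp: bounded_pos)
  have "\<bar>profile p \<gamma> w t\<bar> \<le> C" if "a \<le> t" "t \<le> b" "0 \<le> w" for t w
  proof -
    have "max 0 (1 - t * w) powr \<gamma> \<le> 1"
      using that assms by (intro powr_le1) auto
    hence "\<bar>t powr p\<bar> * (max 0 (1 - t * w)) powr \<gamma> \<le> C * 1"
      by (intro mult_mono C) (use that C in auto)
    thus ?thesis by (simp add: profile_def abs_mult)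
  qed
  with C show ?thesis by blast
qed

text \<open>
  \<open>profile'\<close> and \<open>profile''\<close> arise from their predecessor by the same linear combination, so this
  step carries a uniform bound from one derivative to the next.
\<close>

lemma combination_bound:
  fixes f g :: "real \<Rightarrow> real \<Rightarrow> real"
  assumes "\<exists>C>0. \<forall>t w. P t w \<longrightarrow> \<bar>f w t\<bar> \<le> C" "\<exists>C>0. \<forall>t w. P t w \<longrightarrow> \<bar>g w t\<bar> \<le> C"
    and w: "\<And>t w. P t w \<Longrightarrow> 0 \<le> w \<and> w \<le> w0"
  shows "\<exists>C>0. \<forall>t w. P t w \<longrightarrow> \<bar>p * f w t - q * w * g w t\<bar> \<le> C"
proof -
  obtain C D where C: "C > 0" "\<And>t w. P t w \<Longrightarrow> \<bar>f w t\<bar> \<le> C"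
    and D: "D > 0" "\<And>t w. P t w \<Longrightarrow> \<bar>g w t\<bar> \<le> D"
    using assms(1,2) by metis
  have "\<bar>p * f w t - q * w * g w t\<bar> \<le> \<bar>p\<bar> * C + \<bar>q\<bar> * \<bar>w0\<bar> * D + 1" if "P t w" for t w
  proof -
    have "\<bar>p * f w t - q * w * g w t\<bar> \<le> \<bar>p * f w t\<bar> + \<bar>q * w * g w t\<bar>" by simp
    also have "\<dots> \<le> \<bar>p\<bar> * C + \<bar>q\<bar> * \<bar>w0\<bar> * D"
      unfolding abs_mult using C D w[OF that] that
      by (intro add_mono mult_mono) auto
    finally show ?thesis by simp
  qed
  moreover have "\<bar>p\<bar> * C + \<bar>q\<bar> * \<bar>w0\<bar> * D + 1 > 0"
    using C D by (intro add_nonneg_pos add_nonneg_nonneg mult_nonneg_nonneg) auto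
  ultimately show ?thesis by blast
qed

lemma profile'_bound:
  assumes "0 < a" "a \<le> b" "\<gamma> > 1"
  shows "\<exists>C>0. \<forall>t w. a \<le> t \<and> t \<le> b \<and> 0 \<le> w \<and> w \<le> w0 \<longrightarrow> \<bar>profile' p \<gamma> w t\<bar> \<le> C"
proof -
  have "\<exists>C>0. \<forall>t w. a \<le> t \<and> t \<le> b \<and> 0 \<le> w \<and> w \<le> w0 \<longrightarrow> \<bar>profile p \<gamma> w t\<bar> \<le> C"
    if "\<gamma> > 0" for p \<gamma>
    using profile_bound[OF assms(1,2) that, of p] by blast
  thus ?thesis unfolding profile'_def
    by (intro combination_bound) (use assms in auto)
qed

lemma profile''_bound:
  assumes "0 < a" "a \<le> b" "\<gamma> > 2"
  shows "\<exists>C>0. \<forall>t w. a \<le> t \<and> t \<le> b \<and> 0 \<le> w \<and> w \<le> w0 \<longrightarrow> \<bar>profile'' p \<gamma> w t\<bar> \<le> C"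
  unfolding profile''_def
  by (intro combination_bound profile'_bound) (use assms in auto)

lemma measurable_profile [measurable]:
  assumes [measurable]: "w \<in> borel_measurable M" "t \<in> borel_measurable M"
  shows "(\<lambda>x. profile p \<gamma> (w x) (t x)) \<in> borel_measurable M"
    "(\<lambda>x. profile' p \<gamma> (w x) (t x)) \<in> borel_measurable M"
    "(\<lambda>x. profile'' p \<gamma> (w x) (t x)) \<in> borel_measurable M"
  unfolding profile''_def profile'_def profile_def by measurable

section \<open>Integrals over Euclidean space and moments of the profile\<close>

lemma lborel_integral_affine:
  fixes f :: "'a::euclidean_space \<Rightarrow> real"
  assumes [measurable]: "f \<in> borel_measurable borel" and c: "c \<noteq> 0"
  shows "(LINT x|lborel. f x) = \<bar>c\<bar> ^ DIM('a) * (LINT x|lborel. f (z + c *\<^sub>R x))"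
  by (subst lborel_affine[OF c, of z]) (simp add: integral_density integral_distr)

lemma integrable_indicator_cball:
  "integrable lborel (indicator (cball z R) :: 'a::euclidean_space \<Rightarrow> real)"
  using emeasure_bounded_finite[OF bounded_cball[of z R]] by (simp add: integrable_indicator_iff)

lemma integrable_on_cball:
  fixes f :: "'a::euclidean_space \<Rightarrow> real"
  assumes [measurable]: "f \<in> borel_measurable borel"
    and bound: "\<And>u. \<bar>f u\<bar> \<le> C * indicator (cball 0 R) u"
  shows "integrable lborel f"
proof (rule Bochner_Integration.integrable_bound)
  show "integrable lborel (\<lambda>u::'a. C * indicator (cball 0 R) u)"
    by (intro integrable_mult_right integrable_indicator_cball)
  show "AE u in lborel. norm (f u) \<le> norm (C * indicator (cball 0 R) u)"
    using bound by (intro always_eventually) (auto intro: order_trans[OF _ abs_ge_self])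
qed simp

lemma dominated_convergence_on_cball:
  fixes f :: "nat \<Rightarrow> 'a::euclidean_space \<Rightarrow> real"
  assumes meas [measurable]: "\<And>n. f n \<in> borel_measurable borel" "g \<in> borel_measurable borel"
    and bound: "\<forall>\<^sub>F n in sequentially. \<forall>u. \<bar>f n u\<bar> \<le> C * indicator (cball 0 R) u"
    and lim: "\<And>u. (\<lambda>n. f n u) \<longlonglongrightarrow> g u"
  shows "(\<lambda>n. LINT u|lborel. f n u) \<longlonglongrightarrow> (LINT u|lborel. g u)"
proof -
  obtain N where N: "\<And>n u. n \<ge> N \<Longrightarrow> \<bar>f n u\<bar> \<le> C * indicator (cball 0 R) u"
    using bound by (auto simp: eventually_sequentially)
  have "(\<lambda>n. LINT u|lborel. f (n + N) u) \<longlonglongrightarrow> (LINT u|lborel. g u)"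
  proof (rule integral_dominated_convergence)
    show "integrable lborel (\<lambda>u::'a. C * indicator (cball 0 R) u)"
      by (intro integrable_mult_right integrable_indicator_cball)
    show "AE u in lborel. (\<lambda>n. f (n + N) u) \<longlonglongrightarrow> g u"
      using lim by (intro always_eventually) (auto intro: LIMSEQ_ignore_initial_segment)
    show "AE u in lborel. norm (f (n + N) u) \<le> C * indicator (cball 0 R) u" for n
      using N by (intro always_eventually) auto
  qed simp_all
  thus ?thesis by (rule LIMSEQ_offset)
qed

lemma integral_odd_eq_0:
  fixes f :: "'a::euclidean_space \<Rightarrow> real"
  assumes "f \<in> borel_measurable borel" and odd: "\<And>u. f (- u) = - f u"
  shows "(LINT u|lborel. f u) = 0"
  using lborel_integral_affine[OF assms(1), of "-1" 0] by (simp add: odd)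

text \<open>
  Replacing \<open>u\<close> by \<open>sqrt t * u\<close> produces \<open>sqrt t ^ d\<close> from the volume and another \<open>t\<close> from the
  quadratic homogeneity of \<open>q\<close>; together they are the prefactor of the profile with exponent
  \<open>d/2 + 1\<close>. This is the exponent that results from weights equal to the square root of the
  relative intensity.
\<close>

lemma profile_moment_scaling:
  fixes q :: "'a::euclidean_space \<Rightarrow> real"
  assumes [measurable]: "q \<in> borel_measurable borel"
    and hom: "\<And>c u. q (c *\<^sub>R u) = c\<^sup>2 * q u" and t: "t > 0"
  shows "(LINT u|lborel. profile (DIM('a) / 2 + 1) \<gamma> (u \<bullet> u) t * q u)
       = (LINT u|lborel. profile (DIM('a) / 2 + 1) \<gamma> (u \<bullet> u) 1 * q u)"
proof -
  have sq: "sqrt t ^ DIM('a) * t = t powr (DIM('a) / 2 + 1)"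
    using t by (simp add: powr_add powr_powr flip: powr_half_sqrt powr_realpow)
  have "(LINT u|lborel. profile (DIM('a) / 2 + 1) \<gamma> (u \<bullet> u) 1 * q u)
      = \<bar>sqrt t\<bar> ^ DIM('a) * (LINT u|lborel. profile (DIM('a) / 2 + 1) \<gamma>
          ((0 + sqrt t *\<^sub>R u) \<bullet> (0 + sqrt t *\<^sub>R u)) 1 * q (0 + sqrt t *\<^sub>R u))"
    by (rule lborel_integral_affine) (use t in auto)
  also have "\<dots> = (LINT u|lborel. \<bar>sqrt t\<bar> ^ DIM('a) * (profile (DIM('a) / 2 + 1) \<gamma>
          ((0 + sqrt t *\<^sub>R u) \<bullet> (0 + sqrt t *\<^sub>R u)) 1 * q (0 + sqrt t *\<^sub>R u)))"
    by simp
  also have "\<dots> = (LINT u|lborel. profile (DIM('a) / 2 + 1) \<gamma> (u \<bullet> u) t * q u)"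
  proof (intro Bochner_Integration.integral_cong refl)
    fix u :: 'a
    have eq: "sqrt t * (sqrt t * (u \<bullet> u)) = t * (u \<bullet> u)"
      using t by (simp flip: mult.assoc)
    show "\<bar>sqrt t\<bar> ^ DIM('a) * (profile (DIM('a) / 2 + 1) \<gamma>
          ((0 + sqrt t *\<^sub>R u) \<bullet> (0 + sqrt t *\<^sub>R u)) 1 * q (0 + sqrt t *\<^sub>R u))
      = profile (DIM('a) / 2 + 1) \<gamma> (u \<bullet> u) t * q u"
      using t by (simp add: profile_def hom eq flip: sq)
  qed
  finally show ?thesis by simp
qed

text \<open>
  Differentiating the constant function of \<open>t\<close> in \<open>profile_moment_scaling\<close> under the integral. Both
  derivatives come from one application of dominated convergence: the integrated second order
  difference quotient at \<open>1\<close> converges, but by constancy it equals \<open>- I / h\<close> with \<open>I\<close> the first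
  derivative. So \<open>I\<close> is zero, and then so is the limit.
\<close>

lemma profile_moment_derivatives_vanish:
  fixes q :: "'a::euclidean_space \<Rightarrow> real"
  assumes [measurable]: "q \<in> borel_measurable borel" and \<gamma>: "\<gamma> > 2"
    and hom: "\<And>c u. q (c *\<^sub>R u) = c\<^sup>2 * q u"
    and bound: "\<And>u. norm u \<le> 1 \<Longrightarrow> \<bar>q u\<bar> \<le> B"
  shows "(LINT u|lborel. profile' (DIM('a) / 2 + 1) \<gamma> (u \<bullet> u) 1 * q u) = 0"
    and "(LINT u|lborel. profile'' (DIM('a) / 2 + 1) \<gamma> (u \<bullet> u) 1 * q u) = 0"
proof -
  define p where "p = DIM('a) / 2 + 1"
  define h where "h = (\<lambda>n::nat. 1 / real (Suc n))"
  have h: "h n > 0" "h n \<le> 1" for n by (auto simp: h_def)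
  have h0: "h \<longlonglongrightarrow> 0" unfolding h_def by (rule LIMSEQ_Suc[OF lim_1_over_n])
  have norm_le: "norm u \<le> 1 \<longleftrightarrow> u \<bullet> u \<le> 1" for u :: 'a
    by (simp add: norm_eq_sqrt_inner)
  have B: "B \<ge> 0" using bound[of 0] by simp
  obtain C0 where C0: "C0 > 0" "\<And>t w. 1 \<le> t \<Longrightarrow> t \<le> 2 \<Longrightarrow> 0 \<le> w \<Longrightarrow> \<bar>profile p \<gamma> w t\<bar> \<le> C0"
    using profile_bound[of 1 2 \<gamma> p] \<gamma> by auto
  obtain C1 where C1: "C1 > 0" "\<And>t w. 1 \<le> t \<Longrightarrow> t \<le> 2 \<Longrightarrow> 0 \<le> w \<Longrightarrow> w \<le> 1 \<Longrightarrow> \<bar>profile' p \<gamma> w t\<bar> \<le> C1"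
    using profile'_bound[of 1 2 \<gamma> 1 p] \<gamma> by auto
  obtain C2 where C2: "C2 > 0" "\<And>t w. 1 \<le> t \<Longrightarrow> t \<le> 2 \<Longrightarrow> 0 \<le> w \<Longrightarrow> w \<le> 1 \<Longrightarrow> \<bar>profile'' p \<gamma> w t\<bar> \<le> C2"
    using profile''_bound[of 1 2 \<gamma> 1 p] \<gamma> by auto
  have int0: "integrable lborel (\<lambda>u::'a. profile p \<gamma> (u \<bullet> u) t * q u)" if "1 \<le> t" "t \<le> 2" for t
  proof (rule integrable_on_cball)
    fix u :: 'a
    show "\<bar>profile p \<gamma> (u \<bullet> u) t * q u\<bar> \<le> (C0 * B) * indicator (cball 0 1) u"
    proof (cases "norm u \<le> 1")
      case True
      thus ?thesis unfolding abs_mult using that C0 B by (auto intro!: mult_mono bound)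
    next
      case False
      hence "1 * 1 \<le> t * (u \<bullet> u)" using that by (intro mult_mono) (auto simp: norm_le)
      thus ?thesis using False by (simp add: profile_outside)
    qed
  qed measurable
  have int1: "integrable lborel (\<lambda>u::'a. profile' p \<gamma> (u \<bullet> u) 1 * q u)"
  proof (rule integrable_on_cball)
    fix u :: 'a
    show "\<bar>profile' p \<gamma> (u \<bullet> u) 1 * q u\<bar> \<le> (C1 * B) * indicator (cball 0 1) u"
    proof (cases "norm u \<le> 1")
      case True
      thus ?thesis unfolding abs_mult using C1 B by (auto intro!: mult_mono bound simp: norm_le)
    next
      case False
      thus ?thesis by (simp add: profile'_outside norm_le)
    qed
  qed measurable
  define I where "I = (LINT u::'a|lborel. profile' p \<gamma> (u \<bullet> u) 1 * q u)"
  \<comment> \<open>The factor 1 is the velocity of t = 1 + h; it matches the shape of the chain rule limit.\<close>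
  define D where "D = (\<lambda>n (u::'a). (profile p \<gamma> (u \<bullet> u) (1 + h n) - profile p \<gamma> (u \<bullet> u) 1
      - h n * profile' p \<gamma> (u \<bullet> u) 1 * 1) / (h n)\<^sup>2 * q u)"
  have "(\<lambda>n. LINT u|lborel. D n u) \<longlonglongrightarrow>
      (LINT u::'a|lborel. (profile' p \<gamma> (u \<bullet> u) 1 * 0 + profile'' p \<gamma> (u \<bullet> u) 1 / 2 * 1\<^sup>2) * q u)"
  proof (rule dominated_convergence_on_cball)
    show "D n \<in> borel_measurable borel" for n unfolding D_def by measurable
    show "(\<lambda>u::'a. (profile' p \<gamma> (u \<bullet> u) 1 * 0 + profile'' p \<gamma> (u \<bullet> u) 1 / 2 * 1\<^sup>2) * q u) \<in> borel_measurable borel"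
      by measurable
    fix u :: 'a
    show "(\<lambda>n. D n u) \<longlonglongrightarrow> (profile' p \<gamma> (u \<bullet> u) 1 * 0 + profile'' p \<gamma> (u \<bullet> u) 1 / 2 * 1\<^sup>2) * q u"
      unfolding D_def
    proof (intro tendsto_mult tendsto_const second_order_chain_limit[where a = "1/2" and b = 2])
      fix s :: real assume "1/2 \<le> s"
      thus "(profile p \<gamma> (u \<bullet> u) has_real_derivative profile' p \<gamma> (u \<bullet> u) s) (at s)"
        "(profile' p \<gamma> (u \<bullet> u) has_real_derivative profile'' p \<gamma> (u \<bullet> u) s) (at s)"
        using \<gamma> by (auto intro!: profile_DERIV profile'_DERIV)
    next
      show "\<forall>\<^sub>F n in sequentially. 1/2 \<le> 1 + h n \<and> 1 + h n \<le> 2"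
      proof (intro always_eventually allI)
        show "1/2 \<le> 1 + h n \<and> 1 + h n \<le> 2" for n using h[of n] by linarith
      qed
    qed (use h h0 \<gamma> in \<open>auto intro: isCont_profile''\<close>)
  next
    show "\<forall>\<^sub>F n in sequentially. \<forall>u. \<bar>D n u\<bar> \<le> C2 / 2 * B * indicator (cball 0 1) u"
    proof (intro always_eventually allI)
      fix n and u :: 'a
      show "\<bar>D n u\<bar> \<le> C2 / 2 * B * indicator (cball 0 1) u"
      proof (cases "norm u \<le> 1")
        case True
        obtain \<xi> where \<xi>: "1 \<le> \<xi>" "\<xi> \<le> 2" "profile p \<gamma> (u \<bullet> u) (1 + h n) = profile p \<gamma> (u \<bullet> u) 1
            + profile' p \<gamma> (u \<bullet> u) 1 * ((1 + h n) - 1) + profile'' p \<gamma> (u \<bullet> u) \<xi> / 2 * ((1 + h n) - 1)\<^sup>2"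
          by (rule taylor_second_order[of 1 2 "profile p \<gamma> (u \<bullet> u)" "profile' p \<gamma> (u \<bullet> u)"
                "profile'' p \<gamma> (u \<bullet> u)" 1 "1 + h n"])
             (use \<gamma> h[of n] in \<open>auto intro!: profile_DERIV profile'_DERIV\<close>)
        have "D n u = profile'' p \<gamma> (u \<bullet> u) \<xi> / 2 * q u"
          using h(1)[of n] unfolding D_def \<xi>(3) by simp
        also have "\<bar>\<dots>\<bar> \<le> C2 / 2 * B"
          unfolding abs_mult using C2 \<xi> True B
          by (intro mult_mono bound) (auto simp: norm_le)
        finally show ?thesis using True by simp
      next
        case False
        have "1 * 1 \<le> (1 + h n) * (u \<bullet> u)"
          using False h(1)[of n] by (intro mult_mono) (auto simp: norm_le)
        thus ?thesis using False by (simp add: D_def profile_outside profile'_outside norm_le)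
      qed
    qed
  qed
  moreover have "(LINT u|lborel. D n u) = - I / h n" for n
  proof -
    have "(LINT u|lborel. D n u) = (LINT u::'a|lborel. (profile p \<gamma> (u \<bullet> u) (1 + h n) * q u
        - profile p \<gamma> (u \<bullet> u) 1 * q u - h n * (profile' p \<gamma> (u \<bullet> u) 1 * q u)) / (h n)\<^sup>2)"
      unfolding D_def by (intro Bochner_Integration.integral_cong) (auto simp: algebra_simps)
    also have "\<dots> = ((LINT u::'a|lborel. profile p \<gamma> (u \<bullet> u) (1 + h n) * q u)
        - (LINT u::'a|lborel. profile p \<gamma> (u \<bullet> u) 1 * q u) - h n * I) / (h n)\<^sup>2"
      using h[of n] int0[of "1 + h n"] int0[of 1] int1 unfolding I_def by simp
    also have "(LINT u::'a|lborel. profile p \<gamma> (u \<bullet> u) (1 + h n) * q u)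
        = (LINT u::'a|lborel. profile p \<gamma> (u \<bullet> u) 1 * q u)"
      unfolding p_def using h(1)[of n] by (intro profile_moment_scaling hom) auto
    finally show ?thesis using h(1)[of n] by (simp add: power2_eq_square)
  qed
  ultimately have lim: "(\<lambda>n. - I / h n) \<longlonglongrightarrow> (LINT u::'a|lborel. profile'' p \<gamma> (u \<bullet> u) 1 * q u) / 2"
    by simp
  have "(\<lambda>n. h n * (- I / h n)) \<longlonglongrightarrow> 0 * ((LINT u::'a|lborel. profile'' p \<gamma> (u \<bullet> u) 1 * q u) / 2)"
    by (intro tendsto_mult h0 lim)
  moreover have "h n * (- I / h n) = - I" for n using h(1)[of n] by simp
  ultimately have I: "I = 0" by (simp add: LIMSEQ_const_iff)
  show "(LINT u|lborel. profile' (DIM('a) / 2 + 1) \<gamma> (u \<bullet> u) 1 * q u) = 0"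
    using I by (simp add: I_def p_def)
  show "(LINT u|lborel. profile'' (DIM('a) / 2 + 1) \<gamma> (u \<bullet> u) 1 * q u) = 0"
    using lim I by (simp add: LIMSEQ_const_iff p_def)
qed

section \<open>Expansion under a perturbed dilation\<close>

text \<open>
  A sequence of functions \<open>t n\<close> close to \<open>1\<close> with second order expansion \<open>1 + h L + h^2 q\<close>, to be
  thought of as the intensity at \<open>x0 + h u\<close> relative to that at \<open>x0\<close>, extended by zero. The values
  are zero or at least \<open>a\<close>, so that \<open>1 \<le> a * R^2\<close> confines all profiles to the ball of radius \<open>R\<close>.
  The expansion is required only on that ball: pointwise as a limit, and uniformly as a bound, which
  is what dominated convergence asks for. One constant \<open>C\<close> serves for the bound and for \<open>q\<close>.
\<close>

locale dilation_sequence =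
  fixes t :: "nat \<Rightarrow> 'a::euclidean_space \<Rightarrow> real" and h :: "nat \<Rightarrow> real"
    and L q :: "'a \<Rightarrow> real" and a b R C :: real
  assumes t_measurable [measurable]: "\<And>n. t n \<in> borel_measurable borel"
    and q_measurable [measurable]: "q \<in> borel_measurable borel"
    and L_linear: "bounded_linear L"
    and q_hom: "\<And>c u. q (c *\<^sub>R u) = c\<^sup>2 * q u"
    and q_bound: "\<And>u. norm u \<le> R \<Longrightarrow> \<bar>q u\<bar> \<le> C"
    and a: "0 < a" "a \<le> 1" and b: "1 \<le> b" and R: "1 \<le> R" "1 \<le> a * R\<^sup>2"
    and h0: "h \<longlonglongrightarrow> 0" and h_pos: "\<forall>\<^sub>F n in sequentially. h n > 0"
    and t_dich: "\<And>n u. t n u = 0 \<or> a \<le> t n u"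
    and t_range: "\<forall>\<^sub>F n in sequentially. \<forall>u. norm u \<le> R \<longrightarrow> a \<le> t n u \<and> t n u \<le> b"
    and t_expansion: "\<forall>\<^sub>F n in sequentially. \<forall>u. norm u \<le> R \<longrightarrow>
          \<bar>t n u - 1 - h n * L u\<bar> \<le> C * (h n)\<^sup>2"
    and t_limit: "\<And>u. norm u \<le> R \<Longrightarrow> (\<lambda>n. (t n u - 1 - h n * L u) / (h n)\<^sup>2) \<longlonglongrightarrow> q u"
begin

lemma L_measurable [measurable]: "L \<in> borel_measurable borel"
  using L_linear by (intro borel_measurable_continuous_onI linear_continuous_on)

lemma outside_cball:
  assumes "\<not> norm u \<le> R"
  shows "1 \<le> a * (u \<bullet> u)" "1 \<le> u \<bullet> u" "profile p \<gamma> (u \<bullet> u) (t n u) = 0"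
    "profile p \<gamma> (u \<bullet> u) 1 = 0" "profile' p \<gamma> (u \<bullet> u) 1 = 0" "profile'' p \<gamma> (u \<bullet> u) 1 = 0"
proof -
  have "R\<^sup>2 \<le> (norm u)\<^sup>2"
    using assms R by (intro power_mono) auto
  hence Ru: "R\<^sup>2 \<le> u \<bullet> u" by (simp add: power2_norm_eq_inner)
  hence "a * R\<^sup>2 \<le> a * (u \<bullet> u)" using a by (intro mult_left_mono) auto
  thus 1: "1 \<le> a * (u \<bullet> u)" using R by linarith
  have "a * (u \<bullet> u) \<le> 1 * (u \<bullet> u)" using a by (intro mult_right_mono) auto
  with 1 show 2: "1 \<le> u \<bullet> u" by simp
  show "profile p \<gamma> (u \<bullet> u) (t n u) = 0"
  proof (cases "t n u = 0")
    case True
    thus ?thesis by (simp add: profile_zero)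
  next
    case False
    with t_dich have "a \<le> t n u" by blast
    hence "a * (u \<bullet> u) \<le> t n u * (u \<bullet> u)" by (intro mult_right_mono) auto
    with 1 show ?thesis by (intro profile_outside) simp
  qed
  show "profile p \<gamma> (u \<bullet> u) 1 = 0" "profile' p \<gamma> (u \<bullet> u) 1 = 0" "profile'' p \<gamma> (u \<bullet> u) 1 = 0"
    using 2 by (auto intro: profile_outside profile'_outside profile''_outside)
qed

lemma inside_cball: "norm u \<le> R \<Longrightarrow> u \<bullet> u \<le> R\<^sup>2"
  by (metis power2_norm_eq_inner power_mono norm_ge_zero)

lemma L_bound: obtains B where "B > 0" "\<And>u. norm u \<le> R \<Longrightarrow> \<bar>L u\<bar> \<le> B"
proof -
  obtain K where K: "K > 0" "\<And>x. norm (L x) \<le> norm x * K"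
    using bounded_linear.pos_bounded[OF L_linear] by auto
  show ?thesis
  proof (rule that[of "R * K"])
    show "R * K > 0" using K R by (intro mult_pos_pos) auto
    show "\<bar>L u\<bar> \<le> R * K" if "norm u \<le> R" for u
      using K(2)[of u] mult_right_mono[OF that less_imp_le[OF K(1)]] by simp
  qed
qed

lemma profile_taylor:
  assumes "\<gamma> > 2"
  obtains B where "B > 0"
    "\<And>u::'a. norm u \<le> R \<Longrightarrow> \<bar>profile' p \<gamma> (u \<bullet> u) 1\<bar> \<le> B"
    "\<And>(u::'a) s. norm u \<le> R \<Longrightarrow> a \<le> s \<Longrightarrow> s \<le> b \<Longrightarrow>
       \<bar>profile p \<gamma> (u \<bullet> u) s - profile p \<gamma> (u \<bullet> u) 1 - profile' p \<gamma> (u \<bullet> u) 1 * (s - 1)\<bar>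
         \<le> B * (s - 1)\<^sup>2"
proof -
  have ab: "a \<le> b" using a b by linarith
  obtain C1 where C1: "C1 > 0" "\<And>t w. a \<le> t \<Longrightarrow> t \<le> b \<Longrightarrow> 0 \<le> w \<Longrightarrow> w \<le> R\<^sup>2 \<Longrightarrow> \<bar>profile' p \<gamma> w t\<bar> \<le> C1"
    using profile'_bound[of a b \<gamma> "R\<^sup>2" p] assms a ab by auto
  obtain C2 where C2: "C2 > 0" "\<And>t w. a \<le> t \<Longrightarrow> t \<le> b \<Longrightarrow> 0 \<le> w \<Longrightarrow> w \<le> R\<^sup>2 \<Longrightarrow> \<bar>profile'' p \<gamma> w t\<bar> \<le> C2"
    using profile''_bound[of a b \<gamma> "R\<^sup>2" p] assms a ab by auto
  show ?thesis
  proof (rule that[of "C1 + C2"])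
    show "C1 + C2 > 0" using C1 C2 by simp
    fix u :: 'a assume u: "norm u \<le> R"
    have "\<bar>profile' p \<gamma> (u \<bullet> u) 1\<bar> \<le> C1"
      using C1(2)[of 1 "u \<bullet> u"] a b inside_cball[OF u] by simp
    thus "\<bar>profile' p \<gamma> (u \<bullet> u) 1\<bar> \<le> C1 + C2" using C2(1) by simp
    fix s assume s: "a \<le> s" "s \<le> b"
    obtain \<xi> where \<xi>: "a \<le> \<xi>" "\<xi> \<le> b" "profile p \<gamma> (u \<bullet> u) s = profile p \<gamma> (u \<bullet> u) 1
        + profile' p \<gamma> (u \<bullet> u) 1 * (s - 1) + profile'' p \<gamma> (u \<bullet> u) \<xi> / 2 * (s - 1)\<^sup>2"
      by (rule taylor_second_order[of a b "profile p \<gamma> (u \<bullet> u)" "profile' p \<gamma> (u \<bullet> u)"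
            "profile'' p \<gamma> (u \<bullet> u)" 1 s])
         (use assms a b s in \<open>auto intro!: profile_DERIV profile'_DERIV\<close>)
    have "\<bar>profile'' p \<gamma> (u \<bullet> u) \<xi>\<bar> \<le> C2" using C2(2) \<xi> inside_cball[OF u] by simp
    hence "\<bar>profile'' p \<gamma> (u \<bullet> u) \<xi> / 2\<bar> * (s - 1)\<^sup>2 \<le> (C1 + C2) * (s - 1)\<^sup>2"
      using C1(1) by (intro mult_right_mono) auto
    thus "\<bar>profile p \<gamma> (u \<bullet> u) s - profile p \<gamma> (u \<bullet> u) 1 - profile' p \<gamma> (u \<bullet> u) 1 * (s - 1)\<bar>
         \<le> (C1 + C2) * (s - 1)\<^sup>2"
      unfolding \<xi>(3) by (simp add: abs_mult)
  qed
qed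

lemma integrable_profile:
  assumes "\<gamma> > 0"
  shows "integrable lborel (\<lambda>u::'a. profile p \<gamma> (u \<bullet> u) 1)"
    and "\<forall>\<^sub>F n in sequentially. integrable lborel (\<lambda>u. profile p \<gamma> (u \<bullet> u) (t n u))"
proof -
  have ab: "a \<le> b" using a b by linarith
  obtain C0 where C0: "C0 > 0" "\<And>t w. a \<le> t \<Longrightarrow> t \<le> b \<Longrightarrow> 0 \<le> w \<Longrightarrow> \<bar>profile p \<gamma> w t\<bar> \<le> C0"
    using profile_bound[of a b \<gamma> p] assms a ab by auto
  show "integrable lborel (\<lambda>u::'a. profile p \<gamma> (u \<bullet> u) 1)"
  proof (rule integrable_on_cball)
    show "\<bar>profile p \<gamma> (u \<bullet> u) 1\<bar> \<le> C0 * indicator (cball 0 R) u" for u :: 'a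
      using C0(2)[of 1 "u \<bullet> u"] a b outside_cball[of u] by (cases "norm u \<le> R") auto
  qed measurable
  show "\<forall>\<^sub>F n in sequentially. integrable lborel (\<lambda>u. profile p \<gamma> (u \<bullet> u) (t n u))"
    using t_range
  proof eventually_elim
    case (elim n)
    show ?case
    proof (rule integrable_on_cball)
      show "\<bar>profile p \<gamma> (u \<bullet> u) (t n u)\<bar> \<le> C0 * indicator (cball 0 R) u" for u :: 'a
        using C0(2)[of "t n u" "u \<bullet> u"] elim outside_cball[of u] by (cases "norm u \<le> R") auto
    qed measurable
  qed
qed

lemma h_le_1: "\<forall>\<^sub>F n in sequentially. h n \<le> 1"
  using order_tendstoD(2)[OF h0, of 1] by (auto elim: eventually_mono)

lemma C_nonneg: "C \<ge> 0"
  using q_bound[of 0] R by simp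

lemma t_linear_bound:
  obtains B where "B > 0"
    "\<forall>\<^sub>F n in sequentially. \<forall>u. norm u \<le> R \<longrightarrow> \<bar>t n u - 1\<bar> \<le> B * h n"
proof -
  obtain B where B: "B > 0" "\<And>u. norm u \<le> R \<Longrightarrow> \<bar>L u\<bar> \<le> B" by (rule L_bound) blast
  show ?thesis
  proof (rule that[of "B + C"])
    show "B + C > 0" using B C_nonneg by simp
    show "\<forall>\<^sub>F n in sequentially. \<forall>u. norm u \<le> R \<longrightarrow> \<bar>t n u - 1\<bar> \<le> (B + C) * h n"
      using h_pos h_le_1 t_expansion
    proof eventually_elim
      case (elim n)
      show ?case
      proof (intro allI impI)
        fix u :: 'a assume u: "norm u \<le> R"
        have "(h n)\<^sup>2 \<le> h n" using elim by (simp add: power2_eq_square mult_left_le)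
        hence 1: "C * (h n)\<^sup>2 \<le> C * h n" using C_nonneg by (rule mult_left_mono)
        have 2: "\<bar>h n * L u\<bar> \<le> h n * B"
          unfolding abs_mult using elim B u by (intro mult_mono) auto
        have "\<bar>t n u - 1\<bar> \<le> \<bar>t n u - 1 - h n * L u\<bar> + \<bar>h n * L u\<bar>" by linarith
        also have "\<dots> \<le> C * h n + h n * B" using elim(3) u 1 2 by (intro add_mono) force+
        finally show "\<bar>t n u - 1\<bar> \<le> (B + C) * h n" by (simp add: algebra_simps)
      qed
    qed
  qed
qed

text \<open>
  A first order bound is enough here: \<open>t n\<close> is within \<open>O(h)\<close> of \<open>1\<close> uniformly on a bounded set, and
  the profile is Lipschitz in \<open>t\<close> there.
\<close>

lemma profile_integral_perturbation:
  assumes "\<gamma> > 2"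
  shows "(\<lambda>n. (LINT u|lborel. profile p \<gamma> (u \<bullet> u) (t n u)) - (LINT u::'a|lborel. profile p \<gamma> (u \<bullet> u) 1))
     \<in> O(h)"
proof -
  obtain B where B: "B > 0"
    "\<And>u::'a. norm u \<le> R \<Longrightarrow> \<bar>profile' p \<gamma> (u \<bullet> u) 1\<bar> \<le> B"
    "\<And>(u::'a) s. norm u \<le> R \<Longrightarrow> a \<le> s \<Longrightarrow> s \<le> b \<Longrightarrow>
       \<bar>profile p \<gamma> (u \<bullet> u) s - profile p \<gamma> (u \<bullet> u) 1 - profile' p \<gamma> (u \<bullet> u) 1 * (s - 1)\<bar>
         \<le> B * (s - 1)\<^sup>2"
    by (rule profile_taylor[OF assms, of p]) blast
  obtain B' where B': "B' > 0"
    "\<forall>\<^sub>F n in sequentially. \<forall>u. norm u \<le> R \<longrightarrow> \<bar>t n u - 1\<bar> \<le> B' * h n"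
    by (rule t_linear_bound)
  define K where "K = B * B' + B * B'\<^sup>2"
  have int: "integrable lborel (\<lambda>u::'a. profile p \<gamma> (u \<bullet> u) 1)"
    "\<forall>\<^sub>F n in sequentially. integrable lborel (\<lambda>u. profile p \<gamma> (u \<bullet> u) (t n u))"
    using integrable_profile assms by auto
  have "\<forall>\<^sub>F n in sequentially. norm ((LINT u|lborel. profile p \<gamma> (u \<bullet> u) (t n u)) -
      (LINT u::'a|lborel. profile p \<gamma> (u \<bullet> u) 1)) \<le> (K * (LINT u|lborel. indicator (cball (0::'a) R) u)) * norm (h n)"
    using h_pos h_le_1 t_range B'(2) int(2)
  proof eventually_elim
    case (elim n)
    have bound: "\<bar>profile p \<gamma> (u \<bullet> u) (t n u) - profile p \<gamma> (u \<bullet> u) 1\<bar>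
        \<le> (K * h n) * indicator (cball 0 R) u" for u :: 'a
    proof (cases "norm u \<le> R")
      case True
      have t: "\<bar>t n u - 1\<bar> \<le> B' * h n" using elim True by blast
      have "(t n u - 1)\<^sup>2 \<le> (B' * h n)\<^sup>2"
        using power_mono[OF t, of 2] by simp
      also have "\<dots> = B'\<^sup>2 * (h n * h n)" by (simp add: power2_eq_square)
      also have "\<dots> \<le> B'\<^sup>2 * (h n * 1)" using elim by (intro mult_left_mono) auto
      finally have 1: "B * (t n u - 1)\<^sup>2 \<le> B * (B'\<^sup>2 * h n)" using B by simp
      have 2: "\<bar>profile' p \<gamma> (u \<bullet> u) 1 * (t n u - 1)\<bar> \<le> B * (B' * h n)"
        unfolding abs_mult using B(1) by (intro mult_mono B(2) True t) auto
      have "\<bar>profile p \<gamma> (u \<bullet> u) (t n u) - profile p \<gamma> (u \<bullet> u) 1 - profile' p \<gamma> (u \<bullet> u) 1 * (t n u - 1)\<bar>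
         \<le> B * (t n u - 1)\<^sup>2" using B(3) True elim by blast
      hence "\<bar>profile p \<gamma> (u \<bullet> u) (t n u) - profile p \<gamma> (u \<bullet> u) 1\<bar> \<le> B * (B'\<^sup>2 * h n) + B * (B' * h n)"
        using 1 2 by linarith
      thus ?thesis using True by (simp add: K_def algebra_simps)
    next
      case False
      thus ?thesis by (simp add: outside_cball)
    qed
    have "norm ((LINT u|lborel. profile p \<gamma> (u \<bullet> u) (t n u)) - (LINT u::'a|lborel. profile p \<gamma> (u \<bullet> u) 1))
        = norm (LINT u|lborel. profile p \<gamma> (u \<bullet> u) (t n u) - profile p \<gamma> (u \<bullet> u) 1)"
      using int elim by simp
    also have "\<dots> \<le> (LINT u|lborel. (K * h n) * indicator (cball (0::'a) R) u)"
      using int elim bound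
      by (intro Bochner_Integration.integral_norm_bound_integral)
        (auto intro!: integrable_mult_right integrable_indicator_cball)
    also have "\<dots> = (K * (LINT u|lborel. indicator (cball (0::'a) R) u)) * norm (h n)"
      using elim by (simp only: integral_mult_right_zero) simp
    finally show ?case .
  qed
  thus ?thesis by (rule bigoI)
qed

text \<open>
  The central cancellation. Integrating the expansion of the profile to second order in \<open>h\<close>, the
  linear term drops out because \<open>L\<close> is odd, and both quadratic terms because \<open>q\<close> and \<open>L^2\<close> are
  homogeneous of degree two and so fall under \<open>profile_moment_derivatives_vanish\<close>.
\<close>

lemma abramson_cancellation:
  assumes \<gamma>: "\<gamma> > 2"
  shows "(\<lambda>n. (LINT u|lborel. profile (DIM('a) / 2 + 1) \<gamma> (u \<bullet> u) (t n u))
     - (LINT u::'a|lborel. profile (DIM('a) / 2 + 1) \<gamma> (u \<bullet> u) 1)) \<in> o(\<lambda>n. (h n)\<^sup>2)"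
proof -
  define p where "p = DIM('a) / 2 + 1"
  define D where "D = (\<lambda>n u. (profile p \<gamma> (u \<bullet> u) (t n u) - profile p \<gamma> (u \<bullet> u) 1
      - h n * profile' p \<gamma> (u \<bullet> u) 1 * L u) / (h n)\<^sup>2)"
  define G where "G = (\<lambda>u. profile' p \<gamma> (u \<bullet> u) 1 * q u + profile'' p \<gamma> (u \<bullet> u) 1 / 2 * (L u)\<^sup>2)"
  obtain B where B: "B > 0"
    "\<And>u::'a. norm u \<le> R \<Longrightarrow> \<bar>profile' p \<gamma> (u \<bullet> u) 1\<bar> \<le> B"
    "\<And>(u::'a) s. norm u \<le> R \<Longrightarrow> a \<le> s \<Longrightarrow> s \<le> b \<Longrightarrow>
       \<bar>profile p \<gamma> (u \<bullet> u) s - profile p \<gamma> (u \<bullet> u) 1 - profile' p \<gamma> (u \<bullet> u) 1 * (s - 1)\<bar>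
         \<le> B * (s - 1)\<^sup>2"
    by (rule profile_taylor[OF assms, of p]) blast
  obtain B' where B': "B' > 0"
    "\<forall>\<^sub>F n in sequentially. \<forall>u. norm u \<le> R \<longrightarrow> \<bar>t n u - 1\<bar> \<le> B' * h n"
    by (rule t_linear_bound)
  obtain BL where BL: "BL > 0" "\<And>u. norm u \<le> R \<Longrightarrow> \<bar>L u\<bar> \<le> BL" by (rule L_bound) blast
  have L_scale: "L (c *\<^sub>R u) = c * L u" for c u
    using linear_scale[OF bounded_linear.linear[OF L_linear], of c u] by simp
  have C2: "\<exists>C2>0. \<forall>t w. a \<le> t \<and> t \<le> b \<and> 0 \<le> w \<and> w \<le> R\<^sup>2 \<longrightarrow> \<bar>profile'' p \<gamma> w t\<bar> \<le> C2"
    by (rule profile''_bound) (use a b \<gamma> in auto)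
  then obtain C2 where C2: "C2 > 0" "\<And>w. 0 \<le> w \<Longrightarrow> w \<le> R\<^sup>2 \<Longrightarrow> \<bar>profile'' p \<gamma> w 1\<bar> \<le> C2"
    using a b by metis
  have "(\<lambda>n. LINT u|lborel. D n u) \<longlonglongrightarrow> (LINT u|lborel. G u)"
  proof (rule dominated_convergence_on_cball)
    show "D n \<in> borel_measurable borel" for n unfolding D_def by measurable
    show "G \<in> borel_measurable borel" unfolding G_def by measurable
    show "\<forall>\<^sub>F n in sequentially. \<forall>u. \<bar>D n u\<bar> \<le> (B * C + B * B'\<^sup>2) * indicator (cball 0 R) u"
      using h_pos t_range t_expansion B'(2)
    proof eventually_elim
      case (elim n)
      show ?case
      proof
        fix u :: 'a
        show "\<bar>D n u\<bar> \<le> (B * C + B * B'\<^sup>2) * indicator (cball 0 R) u"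
        proof (cases "norm u \<le> R")
          case True
          \<comment> \<open>The numerator splits into the Taylor remainder in t and the error of the expansion of t.\<close>
          define N where "N = profile p \<gamma> (u \<bullet> u) (t n u) - profile p \<gamma> (u \<bullet> u) 1 - h n * profile' p \<gamma> (u \<bullet> u) 1 * L u"
          have t: "\<bar>t n u - 1\<bar> \<le> B' * h n" using elim True by blast
          have "(t n u - 1)\<^sup>2 \<le> (B' * h n)\<^sup>2"
            using power_mono[OF t, of 2] by simp
          hence 1: "B * (t n u - 1)\<^sup>2 \<le> B * (B'\<^sup>2 * (h n)\<^sup>2)" using B by (simp add: power_mult_distrib)
          have 2: "\<bar>profile' p \<gamma> (u \<bullet> u) 1 * (t n u - 1 - h n * L u)\<bar> \<le> B * (C * (h n)\<^sup>2)"
            unfolding abs_mult using B(1) elim True by (intro mult_mono B(2)) auto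
          have 3: "\<bar>profile p \<gamma> (u \<bullet> u) (t n u) - profile p \<gamma> (u \<bullet> u) 1 - profile' p \<gamma> (u \<bullet> u) 1 * (t n u - 1)\<bar>
             \<le> B * (t n u - 1)\<^sup>2" using B(3) True elim by blast
          have "N = (profile p \<gamma> (u \<bullet> u) (t n u) - profile p \<gamma> (u \<bullet> u) 1 - profile' p \<gamma> (u \<bullet> u) 1 * (t n u - 1))
              + profile' p \<gamma> (u \<bullet> u) 1 * (t n u - 1 - h n * L u)"
            by (simp add: N_def algebra_simps)
          hence "\<bar>N\<bar> \<le> B * (B'\<^sup>2 * (h n)\<^sup>2) + B * (C * (h n)\<^sup>2)" using 1 2 3 by linarith
          also have "\<dots> = (B * C + B * B'\<^sup>2) * (h n)\<^sup>2" by (simp add: algebra_simps)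
          finally have "\<bar>N\<bar> / (h n)\<^sup>2 \<le> B * C + B * B'\<^sup>2"
            using elim by (simp add: divide_le_eq)
          thus ?thesis using True by (simp add: D_def N_def)
        next
          case False
          thus ?thesis by (simp add: D_def outside_cball)
        qed
      qed
    qed
    fix u :: 'a
    show "(\<lambda>n. D n u) \<longlonglongrightarrow> G u"
    proof (cases "norm u \<le> R")
      case True
      show ?thesis unfolding D_def G_def
      proof (rule second_order_chain_limit[where a = a and b = b])
        fix s :: real assume "a \<le> s"
        thus "(profile p \<gamma> (u \<bullet> u) has_real_derivative profile' p \<gamma> (u \<bullet> u) s) (at s)"
          "(profile' p \<gamma> (u \<bullet> u) has_real_derivative profile'' p \<gamma> (u \<bullet> u) s) (at s)"
          using \<gamma> a by (auto intro!: profile_DERIV profile'_DERIV)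
      next
        show "\<forall>\<^sub>F n in sequentially. a \<le> t n u \<and> t n u \<le> b"
          using t_range by eventually_elim (use True in auto)
      qed (use a b \<gamma> h0 h_pos t_limit True in \<open>auto intro: isCont_profile''\<close>)
    next
      case False
      thus ?thesis by (simp add: D_def G_def outside_cball)
    qed
  qed
  moreover have "(LINT u|lborel. G u) = 0"
  proof -
    have 1: "integrable lborel (\<lambda>u. profile' p \<gamma> (u \<bullet> u) 1 * q u)"
    proof (rule integrable_on_cball)
      show "\<bar>profile' p \<gamma> (u \<bullet> u) 1 * q u\<bar> \<le> (B * C) * indicator (cball 0 R) u" for u
        unfolding abs_mult using B(1,2) q_bound C_nonneg
        by (cases "norm u \<le> R") (auto simp: outside_cball intro!: mult_mono)
    qed measurable
    have 2: "integrable lborel (\<lambda>u. profile'' p \<gamma> (u \<bullet> u) 1 * (L u)\<^sup>2)"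
    proof (rule integrable_on_cball)
      have "\<bar>(L u)\<^sup>2\<bar> \<le> BL\<^sup>2" if "norm u \<le> R" for u
        using power_mono[OF BL(2)[OF that], of 2] by simp
      thus "\<bar>profile'' p \<gamma> (u \<bullet> u) 1 * (L u)\<^sup>2\<bar> \<le> (C2 * BL\<^sup>2) * indicator (cball 0 R) u" for u
        unfolding abs_mult using C2 BL inside_cball[of u]
        by (cases "norm u \<le> R") (auto simp: outside_cball intro!: mult_mono)
    qed measurable
    have "(LINT u|lborel. G u) = (LINT u|lborel. profile' p \<gamma> (u \<bullet> u) 1 * q u)
        + (LINT u|lborel. profile'' p \<gamma> (u \<bullet> u) 1 * (L u)\<^sup>2) / 2"
      using 1 2 unfolding G_def by simp
    also have "(LINT u|lborel. profile' p \<gamma> (u \<bullet> u) 1 * q u) = 0"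
      unfolding p_def using R q_bound
      by (intro profile_moment_derivatives_vanish(1)[where B = C] \<gamma> q_hom q_measurable) auto
    also have "(LINT u|lborel. profile'' p \<gamma> (u \<bullet> u) 1 * (L u)\<^sup>2) = 0"
      unfolding p_def
    proof (rule profile_moment_derivatives_vanish(2)[where B = "BL\<^sup>2"])
      show "\<bar>(L u)\<^sup>2\<bar> \<le> BL\<^sup>2" if "norm u \<le> 1" for u
        using power_mono[OF BL(2)[of u], of 2] that R by simp
    qed (use \<gamma> in \<open>auto simp: L_scale power_mult_distrib\<close>)
    finally show ?thesis by simp
  qed
  moreover have "\<forall>\<^sub>F n in sequentially. (LINT u|lborel. D n u) =
      ((LINT u|lborel. profile p \<gamma> (u \<bullet> u) (t n u)) - (LINT u::'a|lborel. profile p \<gamma> (u \<bullet> u) 1)) / (h n)\<^sup>2"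
  proof -
    have 1: "integrable lborel (\<lambda>u. profile' p \<gamma> (u \<bullet> u) 1 * L u)"
    proof (rule integrable_on_cball)
      show "\<bar>profile' p \<gamma> (u \<bullet> u) 1 * L u\<bar> \<le> (B * BL) * indicator (cball 0 R) u" for u
        unfolding abs_mult using B(1,2) BL
        by (cases "norm u \<le> R") (auto simp: outside_cball intro!: mult_mono)
    qed measurable
    have 2: "(LINT u|lborel. profile' p \<gamma> (u \<bullet> u) 1 * L u) = 0"
      by (rule integral_odd_eq_0) (use L_scale[of "-1"] in auto)
    have 3: "integrable lborel (\<lambda>u::'a. profile p \<gamma> (u \<bullet> u) 1)"
      "\<forall>\<^sub>F n in sequentially. integrable lborel (\<lambda>u. profile p \<gamma> (u \<bullet> u) (t n u))"
      using integrable_profile \<gamma> by auto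
    from 3(2) show ?thesis
    proof eventually_elim
      case (elim n)
      have "(LINT u|lborel. D n u) = (LINT u|lborel. (profile p \<gamma> (u \<bullet> u) (t n u) - profile p \<gamma> (u \<bullet> u) 1
          - h n * (profile' p \<gamma> (u \<bullet> u) 1 * L u)) / (h n)\<^sup>2)"
        by (simp add: D_def mult.assoc)
      also have "\<dots> = ((LINT u|lborel. profile p \<gamma> (u \<bullet> u) (t n u)) - (LINT u::'a|lborel. profile p \<gamma> (u \<bullet> u) 1)
          - h n * (LINT u|lborel. profile' p \<gamma> (u \<bullet> u) 1 * L u)) / (h n)\<^sup>2"
        using elim 1 3(1) by simp
      finally show ?case using 2 by simp
    qed
  qed
  ultimately have "(\<lambda>n. ((LINT u|lborel. profile p \<gamma> (u \<bullet> u) (t n u))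
      - (LINT u::'a|lborel. profile p \<gamma> (u \<bullet> u) 1)) / (h n)\<^sup>2) \<longlonglongrightarrow> 0"
    by (simp add: tendsto_cong)
  thus ?thesis unfolding p_def
    by (rule smalloI_tendsto) (use h_pos in eventually_elim, auto)
qed

end

section \<open>Second order expansion of the intensity along segments\<close>

text \<open>
  For a function differentiable in the Frechet sense the partial derivatives are the values of the
  derivative on the standard basis, so its derivative in any direction is a combination of them.
\<close>

lemma directional_derivative:
  fixes f :: "real ^ 'n::finite \<Rightarrow> real"
  assumes "f differentiable_on W" "open W" "x + s *\<^sub>R u \<in> W"
  shows "((\<lambda>s. f (x + s *\<^sub>R u)) has_real_derivative
           (\<Sum>i\<in>UNIV. u $ i * partial_deriv i f (x + s *\<^sub>R u))) (at s)"
proof -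
  define y where "y = x + s *\<^sub>R u"
  have "f differentiable (at y)"
    using assms by (simp add: differentiable_on_eq_differentiable_at y_def)
  then obtain f' where f': "(f has_derivative f') (at y)"
    by (auto simp: differentiable_def)
  have chain: "((\<lambda>s. f (z + s *\<^sub>R v)) has_real_derivative f' v) (at r)" if "z + r *\<^sub>R v = y" for z v r
  proof -
    have "((\<lambda>s. z + s *\<^sub>R v) has_derivative (\<lambda>s. s *\<^sub>R v)) (at r)"
      by (auto intro!: derivative_eq_intros)
    hence "((\<lambda>s. f (z + s *\<^sub>R v)) has_derivative (\<lambda>s. f' (s *\<^sub>R v))) (at r)"
      by (rule has_derivative_compose) (use f' that in simp)
    moreover have "f' (s *\<^sub>R v) = f' v * s" for s
      using linear_scale[OF has_derivative_linear[OF f'], of s v] by simp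
    ultimately show ?thesis by (simp add: has_field_derivative_def)
  qed
  have partial: "partial_deriv i f y = f' (axis i 1)" for i
    unfolding partial_deriv_def by (rule DERIV_imp_deriv, rule chain) simp
  have "f' u = f' (\<Sum>i\<in>UNIV. u $ i *\<^sub>R axis i 1)"
    by (rule arg_cong[of _ _ f']) (simp add: vec_eq_iff axis_def if_distrib cong: if_cong)
  also have "\<dots> = (\<Sum>i\<in>UNIV. u $ i * partial_deriv i f y)"
    by (simp add: partial linear_sum[OF has_derivative_linear[OF f']]
        linear_scale[OF has_derivative_linear[OF f']])
  finally show ?thesis using chain[of x s u] by (simp add: y_def)
qed

definition hessian_form :: "(real ^ 'n::finite \<Rightarrow> real) \<Rightarrow> real ^ 'n \<Rightarrow> real ^ 'n \<Rightarrow> real" where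
  "hessian_form f x u = (\<Sum>i\<in>UNIV. u $ i * (\<Sum>j\<in>UNIV. u $ j * partial_deriv j (partial_deriv i f) x))"

definition gradient_form :: "(real ^ 'n::finite \<Rightarrow> real) \<Rightarrow> real ^ 'n \<Rightarrow> real ^ 'n \<Rightarrow> real" where
  "gradient_form f x u = (\<Sum>i\<in>UNIV. u $ i * partial_deriv i f x)"

lemma hessian_form_scaleR: "hessian_form f x (c *\<^sub>R u) = c\<^sup>2 * hessian_form f x u"
  by (simp add: hessian_form_def sum_distrib_left power2_eq_square mult_ac)

lemma bounded_linear_gradient_form: "bounded_linear (gradient_form f x)"
  unfolding gradient_form_def[abs_def]
  by (intro bounded_linear_sum bounded_linear_mult_const bounded_linear_vec_nth)

lemma continuous_hessian_form: "continuous_on UNIV (hessian_form f x)"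
  unfolding hessian_form_def[abs_def] by (intro continuous_intros)

lemma hessian_form_bound:
  fixes f :: "real ^ 'n::finite \<Rightarrow> real"
  assumes "\<And>i j. bounded (partial_deriv i (partial_deriv j f) ` W)"
  shows "\<exists>B>0. \<forall>x\<in>W. \<forall>u. norm u \<le> R \<longrightarrow> \<bar>hessian_form f x u\<bar> \<le> B"
proof -
  have "\<exists>K>0. \<forall>x\<in>W. \<bar>partial_deriv i (partial_deriv j f) x\<bar> \<le> K" for i j
    using assms[of i j] by (auto simp: bounded_pos)
  then obtain K where K: "\<And>i j. K i j > 0"
    "\<And>i j x. x \<in> W \<Longrightarrow> \<bar>partial_deriv i (partial_deriv j f) x\<bar> \<le> K i j"
    by metis
  define B where "B = 1 + (\<Sum>i\<in>UNIV. \<bar>R\<bar> * (\<Sum>j\<in>UNIV. \<bar>R\<bar> * K j i))"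
  have "B > 0" unfolding B_def
    using K(1) by (intro add_pos_nonneg sum_nonneg mult_nonneg_nonneg) (auto intro: less_imp_le)
  moreover have "\<bar>hessian_form f x u\<bar> \<le> B" if "x \<in> W" "norm u \<le> R" for x u
  proof -
    have u: "\<bar>u $ i\<bar> \<le> \<bar>R\<bar>" for i
      using component_le_norm_cart[of u i] that by linarith
    have "\<bar>hessian_form f x u\<bar> \<le> (\<Sum>i\<in>UNIV. \<bar>R\<bar> * (\<Sum>j\<in>UNIV. \<bar>R\<bar> * K j i))"
      unfolding hessian_form_def
    proof (intro order_trans[OF sum_abs] sum_mono)
      fix i
      have "\<bar>\<Sum>j\<in>UNIV. u $ j * partial_deriv j (partial_deriv i f) x\<bar> \<le> (\<Sum>j\<in>UNIV. \<bar>R\<bar> * K j i)"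
        by (intro order_trans[OF sum_abs] sum_mono)
           (auto simp: abs_mult intro!: mult_mono u K(2) that(1))
      thus "\<bar>u $ i * (\<Sum>j\<in>UNIV. u $ j * partial_deriv j (partial_deriv i f) x)\<bar>
          \<le> \<bar>R\<bar> * (\<Sum>j\<in>UNIV. \<bar>R\<bar> * K j i)"
        unfolding abs_mult by (intro mult_mono u) auto
    qed
    thus ?thesis by (simp add: B_def)
  qed
  ultimately show ?thesis by blast
qed

lemma C2_taylor_segment:
  fixes f :: "real ^ 'n::finite \<Rightarrow> real"
  assumes C2: "C2_on W f" and W: "open W"
    and seg: "\<And>s. 0 \<le> s \<Longrightarrow> s \<le> h \<Longrightarrow> x + s *\<^sub>R u \<in> W" and h: "0 \<le> h"
  obtains \<xi> where "0 \<le> \<xi>" "\<xi> \<le> h"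
    "f (x + h *\<^sub>R u) = f x + h * gradient_form f x u + hessian_form f (x + \<xi> *\<^sub>R u) u / 2 * h\<^sup>2"
proof -
  have d: "f differentiable_on W" "\<And>i. partial_deriv i f differentiable_on W"
    using C2 by (auto simp: C2_on_def C1_on_def)
  have 1: "((\<lambda>s. f (x + s *\<^sub>R u)) has_real_derivative gradient_form f (x + s *\<^sub>R u) u) (at s)"
    if "0 \<le> s" "s \<le> h" for s
    unfolding gradient_form_def by (rule directional_derivative[OF d(1) W seg[OF that]])
  have 2: "((\<lambda>s. gradient_form f (x + s *\<^sub>R u) u) has_real_derivative hessian_form f (x + s *\<^sub>R u) u) (at s)"
    if "0 \<le> s" "s \<le> h" for s
    unfolding gradient_form_def hessian_form_def
    by (rule DERIV_sum, rule DERIV_cmult, rule directional_derivative[OF d(2) W seg[OF that]])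
  obtain \<xi> where "0 \<le> \<xi>" "\<xi> \<le> h" "f (x + h *\<^sub>R u) = f (x + 0 *\<^sub>R u) + gradient_form f (x + 0 *\<^sub>R u) u * (h - 0)
      + hessian_form f (x + \<xi> *\<^sub>R u) u / 2 * (h - 0)\<^sup>2"
    by (rule taylor_second_order[of 0 h "\<lambda>s. f (x + s *\<^sub>R u)" "\<lambda>s. gradient_form f (x + s *\<^sub>R u) u"
          "\<lambda>s. hessian_form f (x + s *\<^sub>R u) u" 0 h])
       (use h 1 2 in auto)
  with that[of \<xi>] show ?thesis by (simp add: mult.commute)
qed

text \<open>
  The intermediate points of the Lagrange remainder tend to \<open>x\<close>, where the second derivatives are
  continuous.
\<close>

lemma C2_taylor_limit:
  fixes f :: "real ^ 'n::finite \<Rightarrow> real"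
  assumes C2: "C2_on W f" and W: "open W"
    and seg: "\<forall>\<^sub>F n in sequentially. \<forall>s. 0 \<le> s \<longrightarrow> s \<le> h n \<longrightarrow> x + s *\<^sub>R u \<in> W"
    and h: "h \<longlonglongrightarrow> 0" "\<forall>\<^sub>F n in sequentially. h n > 0" and x: "x \<in> W"
  shows "(\<lambda>n. (f (x + h n *\<^sub>R u) - f x - h n * gradient_form f x u) / (h n)\<^sup>2)
     \<longlonglongrightarrow> hessian_form f x u / 2"
proof -
  have "\<forall>\<^sub>F n in sequentially. \<exists>\<xi>. 0 \<le> \<xi> \<and> \<xi> \<le> h n \<and>
    f (x + h n *\<^sub>R u) = f x + h n * gradient_form f x u + hessian_form f (x + \<xi> *\<^sub>R u) u / 2 * (h n)\<^sup>2"
    using seg h(2)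
  proof eventually_elim
    case (elim n)
    obtain \<xi> where "0 \<le> \<xi>" "\<xi> \<le> h n"
      "f (x + h n *\<^sub>R u) = f x + h n * gradient_form f x u + hessian_form f (x + \<xi> *\<^sub>R u) u / 2 * (h n)\<^sup>2"
      by (rule C2_taylor_segment[OF C2 W _ less_imp_le[OF elim(2)], of x u]) (use elim(1) in blast)+
    thus ?case by blast
  qed
  then obtain \<xi> where \<xi>: "\<forall>\<^sub>F n in sequentially. 0 \<le> \<xi> n \<and> \<xi> n \<le> h n \<and>
    f (x + h n *\<^sub>R u) = f x + h n * gradient_form f x u + hessian_form f (x + \<xi> n *\<^sub>R u) u / 2 * (h n)\<^sup>2"
    unfolding eventually_ex by blast
  have "\<xi> \<longlonglongrightarrow> 0"
    by (rule tendsto_sandwich[OF _ _ tendsto_const h(1)]) (use \<xi> in eventually_elim, auto)+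
  hence "(\<lambda>n. x + \<xi> n *\<^sub>R u) \<longlonglongrightarrow> x + 0 *\<^sub>R u" by (intro tendsto_intros)
  moreover have "isCont (\<lambda>y. hessian_form f y u) x"
  proof -
    have "continuous_on W (partial_deriv j (partial_deriv i f))" for i j
      using C2 by (auto simp: C2_on_def C1_on_def)
    hence "continuous_on W (\<lambda>y. hessian_form f y u)"
      unfolding hessian_form_def by (intro continuous_intros)
    thus ?thesis using W x by (simp add: continuous_on_eq_continuous_at)
  qed
  ultimately have "(\<lambda>n. hessian_form f (x + \<xi> n *\<^sub>R u) u) \<longlonglongrightarrow> hessian_form f x u"
    using isCont_tendsto_compose[of x "\<lambda>y. hessian_form f y u" "\<lambda>n. x + \<xi> n *\<^sub>R u"] by simp
  hence "(\<lambda>n. hessian_form f (x + \<xi> n *\<^sub>R u) u / 2) \<longlonglongrightarrow> hessian_form f x u / 2"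
    by (intro tendsto_intros) auto
  moreover have "\<forall>\<^sub>F n in sequentially. hessian_form f (x + \<xi> n *\<^sub>R u) u / 2
      = (f (x + h n *\<^sub>R u) - f x - h n * gradient_form f x u) / (h n)\<^sup>2"
    using \<xi> h(2) by eventually_elim auto
  ultimately show ?thesis by (rule Lim_transform_eventually)
qed

section \<open>Moments of sums over point processes and of independent averages\<close>

lemma space_config_space: "space config_space = {\<phi>. locally_finite_config \<phi>}"
  unfolding config_space_def by (rule space_measure_of) auto

lemma finite_config_Int:
  assumes "\<phi> \<in> space config_space" "bounded W"
  shows "finite (\<phi> \<inter> W)"
  using assms by (auto simp: space_config_space locally_finite_config_def)

lemma measurable_config_card:
  assumes "B \<in> sets borel" "bounded B"
  shows "(\<lambda>\<phi>. card (\<phi> \<inter> B)) \<in> config_space \<rightarrow>\<^sub>M count_space UNIV"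
proof -
  have "(\<lambda>\<phi>. card (\<phi> \<inter> B)) -` {k} \<inter> space config_space \<in> sets config_space" for k
  proof -
    have "(\<lambda>\<phi>. card (\<phi> \<inter> B)) -` {k} \<inter> space config_space
        = {\<phi>. locally_finite_config \<phi> \<and> card (\<phi> \<inter> B) = k}"
      by (auto simp: space_config_space)
    also have "\<dots> \<in> sets config_space"
      unfolding config_space_def using assms by (intro in_measure_of) auto
    finally show ?thesis .
  qed
  thus ?thesis by (auto simp: measurable_count_space_eq2_countable)
qed

text \<open>
  The counts of points in bounded Borel sets are measurable by the choice of the \<open>\<sigma>\<close>-algebra;
  monotone approximation extends this to sums of Borel functions over the points.
\<close>

lemma measurable_config_nn_sum:
  fixes f :: "'a::euclidean_space \<Rightarrow> ennreal"
  assumes f: "f \<in> borel_measurable borel" and W: "W \<in> sets borel" "bounded W"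
  shows "(\<lambda>\<phi>. \<integral>\<^sup>+y. f y \<partial>count_space (\<phi> \<inter> W)) \<in> borel_measurable config_space"
  using f
proof (induction rule: borel_measurable_induct)
  case (cong f g)
  hence "f = g" by (auto simp: fun_eq_iff)
  thus ?case using cong by simp
next
  case (set A)
  have "(\<lambda>\<phi>. of_nat (card (\<phi> \<inter> (W \<inter> A))) :: ennreal) \<in> borel_measurable config_space"
    by (rule measurable_compose[OF measurable_config_card]) (use W set in \<open>auto intro: bounded_subset\<close>)
  moreover have "(\<integral>\<^sup>+y. indicator A y \<partial>count_space (\<phi> \<inter> W)) = of_nat (card (\<phi> \<inter> (W \<inter> A)))"
    if "\<phi> \<in> space config_space" for \<phi>
  proof -
    note fin = finite_config_Int[OF that W(2)]
    have "(\<integral>\<^sup>+y. indicator A y \<partial>count_space (\<phi> \<inter> W)) = (\<Sum>y\<in>\<phi> \<inter> W. indicator A y)"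
      by (rule nn_integral_count_space_finite[OF fin])
    also have "\<dots> = of_nat (card (\<phi> \<inter> W \<inter> A))"
      using fin by (simp add: indicator_def sum.If_cases Int_def)
    finally show ?thesis by (simp add: Int_assoc)
  qed
  ultimately show ?case by (subst measurable_cong) auto
next
  case (mult u c)
  thus ?case by (simp add: nn_integral_cmult)
next
  case (add u v)
  thus ?case by (simp add: nn_integral_add)
next
  case (seq U)
  have "(\<integral>\<^sup>+y. (SUP i. U i) y \<partial>count_space (\<phi> \<inter> W)) = (SUP i. \<integral>\<^sup>+y. U i y \<partial>count_space (\<phi> \<inter> W))" for \<phi>
    using nn_integral_monotone_convergence_SUP[OF \<open>incseq U\<close>, of "count_space (\<phi> \<inter> W)"]
    by (simp add: image_comp)
  thus ?case using seq by simp
qed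

lemma config_sum_eq_nn_integral:
  fixes f :: "'a::euclidean_space \<Rightarrow> real"
  assumes "\<phi> \<in> space config_space" "bounded W" "\<And>y. 0 \<le> f y"
  shows "(\<integral>\<^sup>+y. ennreal (f y) \<partial>count_space (\<phi> \<inter> W)) = ennreal (\<Sum>y\<in>\<phi> \<inter> W. f y)"
  using finite_config_Int[OF assms(1,2)] assms(3)
  by (simp add: nn_integral_count_space_finite)

lemma measurable_config_sum:
  fixes f :: "'a::euclidean_space \<Rightarrow> real"
  assumes [measurable]: "f \<in> borel_measurable borel" and W: "W \<in> sets borel" "bounded W"
    and nonneg: "\<And>y. 0 \<le> f y"
  shows "(\<lambda>\<phi>. \<Sum>y\<in>\<phi> \<inter> W. f y) \<in> borel_measurable config_space"
proof -
  have "(\<lambda>\<phi>. enn2real (\<integral>\<^sup>+y. ennreal (f y) \<partial>count_space (\<phi> \<inter> W))) \<in> borel_measurable config_space"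
    by (intro borel_measurable_enn2real measurable_config_nn_sum W) measurable
  moreover have "enn2real (\<integral>\<^sup>+y. ennreal (f y) \<partial>count_space (\<phi> \<inter> W)) = (\<Sum>y\<in>\<phi> \<inter> W. f y)"
    if "\<phi> \<in> space config_space" for \<phi>
    using config_sum_eq_nn_integral[OF that W(2) nonneg] nonneg by (simp add: sum_nonneg)
  ultimately show ?thesis by (subst (asm) measurable_cong) auto
qed

lemma sum_power2_eq_diagonal_plus_distinct:
  fixes f :: "'a \<Rightarrow> real"
  assumes "finite A"
  shows "(\<Sum>y\<in>A. f y)\<^sup>2 = (\<Sum>y\<in>A. (f y)\<^sup>2) + (\<Sum>p | fst p \<in> A \<and> snd p \<in> A \<and> fst p \<noteq> snd p. f (fst p) * f (snd p))"
proof -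
  have "(\<Sum>y\<in>A. f y)\<^sup>2 = (\<Sum>p\<in>A \<times> A. f (fst p) * f (snd p))"
    by (simp add: power2_eq_square sum_product sum.cartesian_product case_prod_unfold)
  also have "A \<times> A = (\<lambda>y. (y, y)) ` A \<union> {p. fst p \<in> A \<and> snd p \<in> A \<and> fst p \<noteq> snd p}"
    by auto
  also have "(\<Sum>p\<in>\<dots>. f (fst p) * f (snd p)) = (\<Sum>p\<in>(\<lambda>y. (y, y)) ` A. f (fst p) * f (snd p))
      + (\<Sum>p | fst p \<in> A \<and> snd p \<in> A \<and> fst p \<noteq> snd p. f (fst p) * f (snd p))"
    by (rule sum.union_disjoint)
       (use assms in \<open>auto intro: finite_subset[of _ "A \<times> A"]\<close>)
  also have "(\<Sum>p\<in>(\<lambda>y. (y, y)) ` A. f (fst p) * f (snd p)) = (\<Sum>y\<in>A. (f y)\<^sup>2)"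
    by (subst sum.reindex) (auto simp: inj_on_def power2_eq_square)
  finally show ?thesis .
qed

lemma nn_integral_intensity:
  fixes v lam :: "'a::euclidean_space \<Rightarrow> real"
  assumes lam: "set_borel_measurable borel W lam" "\<And>u. u \<in> W \<Longrightarrow> 0 \<le> lam u \<and> lam u \<le> K"
    and W: "W \<in> sets borel" "bounded W"
    and v: "v \<in> borel_measurable borel" "\<And>u. 0 \<le> v u" "\<And>u. v u \<le> F"
  shows "(\<integral>\<^sup>+u\<in>W. ennreal (v u) * ennreal (lam u) \<partial>lborel)
       = ennreal (LINT u|lborel. indicator W u * (v u * lam u))"
proof -
  have "(\<lambda>u. v u * (indicator W u * lam u)) \<in> borel_measurable borel"
    using lam(1) v(1) unfolding set_borel_measurable_def by (simp add: borel_measurable_times)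
  hence [measurable]: "(\<lambda>u. indicator W u * (v u * lam u)) \<in> borel_measurable borel"
    by (simp add: mult_ac)
  have "integrable lborel (\<lambda>u. indicator W u * (v u * lam u))"
  proof (rule Bochner_Integration.integrable_bound)
    show "integrable lborel (\<lambda>u. (F * K) * indicator W u :: real)"
      using emeasure_bounded_finite[OF W(2)] W(1)
      by (intro integrable_mult_right integrable_real_indicator) auto
    have "\<bar>indicator W u * (v u * lam u)\<bar> \<le> \<bar>F * K * indicator W u\<bar>" for u
      using v(2,3)[of u] lam(2)[of u]
      by (cases "u \<in> W") (auto simp: abs_mult intro!: mult_mono)
    thus "AE u in lborel. norm (indicator W u * (v u * lam u)) \<le> norm (F * K * indicator W u)"
      by (intro always_eventually) auto
  qed simp
  moreover have "0 \<le> indicator W u * (v u * lam u)" for u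
    using v(2)[of u] lam(2)[of u] by (cases "u \<in> W") auto
  ultimately have "(\<integral>\<^sup>+u. ennreal (indicator W u * (v u * lam u)) \<partial>lborel)
       = ennreal (LINT u|lborel. indicator W u * (v u * lam u))"
    by (intro nn_integral_eq_integral) auto
  moreover have "(\<integral>\<^sup>+u\<in>W. ennreal (v u) * ennreal (lam u) \<partial>lborel)
      = (\<integral>\<^sup>+u. ennreal (indicator W u * (v u * lam u)) \<partial>lborel)"
    using v(2) lam(2) by (intro nn_integral_cong) (auto simp: ennreal_mult split: split_indicator)
  ultimately show ?thesis by simp
qed

text \<open>
  With \<open>g\<close> at most \<open>G\<close> the product density is at most \<open>G\<close> times the product of the intensities, for
  which the double integral factorises.
\<close>

lemma second_moment_measure_bound:
  fixes f lam :: "'a::euclidean_space \<Rightarrow> real"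
  assumes lam: "set_borel_measurable borel W lam" "\<And>u. u \<in> W \<Longrightarrow> 0 < lam u"
    and W: "W \<in> sets borel"
    and f: "f \<in> borel_measurable borel" "\<And>u. 0 \<le> f u"
    and g: "\<And>u v. u \<in> W \<Longrightarrow> v \<in> W \<Longrightarrow> pair_correlation lam \<rho> u v \<le> G" and G: "0 \<le> G"
  shows "(\<integral>\<^sup>+p\<in>W \<times> W. (ennreal (f (fst p)) * ennreal (f (snd p))) * ennreal (\<rho> p) \<partial>lborel)
     \<le> ennreal G * (\<integral>\<^sup>+u\<in>W. ennreal (f u) * ennreal (lam u) \<partial>lborel)\<^sup>2"
proof -
  define v where "v = (\<lambda>u. ennreal (f u * (indicator W u * lam u)))"
  have [measurable]: "v \<in> borel_measurable borel"
    using lam(1) f(1) unfolding v_def set_borel_measurable_def by simp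
  have v: "v u = ennreal (f u) * ennreal (lam u) * indicator W u" for u
    using f(2)[of u] lam(2)[of u] by (auto simp: v_def ennreal_mult split: split_indicator)
  have "(\<integral>\<^sup>+p\<in>W \<times> W. (ennreal (f (fst p)) * ennreal (f (snd p))) * ennreal (\<rho> p) \<partial>lborel)
     \<le> (\<integral>\<^sup>+p. ennreal G * (v (fst p) * v (snd p)) \<partial>lborel)"
  proof (rule nn_integral_mono)
    fix p :: "'a \<times> 'a"
    show "(ennreal (f (fst p)) * ennreal (f (snd p))) * ennreal (\<rho> p) * indicator (W \<times> W) p
        \<le> ennreal G * (v (fst p) * v (snd p))"
    proof (cases "p \<in> W \<times> W")
      case True
      then obtain u w where p: "p = (u, w)" "u \<in> W" "w \<in> W" by auto
      have pos: "lam u > 0" "lam w > 0" using lam(2) p by auto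
      have "\<rho> p \<le> G * (lam u * lam w)"
        using g[OF p(2,3)] pos by (simp add: pair_correlation_def p divide_le_eq)
      hence "f u * f w * \<rho> p \<le> f u * f w * (G * (lam u * lam w))"
        using f(2) by (intro mult_left_mono) auto
      hence "ennreal (f u * f w * \<rho> p) \<le> ennreal (G * ((f u * lam u) * (f w * lam w)))"
        by (intro ennreal_leI) (simp add: mult_ac)
      moreover have "ennreal (G * ((f u * lam u) * (f w * lam w))) = ennreal G * (v u * v w)"
        using p G f(2) pos by (simp add: v_def ennreal_mult)
      moreover have "ennreal (f u * f w * \<rho> p) = ennreal (f u) * ennreal (f w) * ennreal (\<rho> p)"
        using f(2) by (simp add: ennreal_mult' ennreal_mult'')
      ultimately show ?thesis using True by (simp add: p)
    qed simp
  qed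
  also have "\<dots> = (\<integral>\<^sup>+p. ennreal G * (v (fst p) * v (snd p)) \<partial>(lborel \<Otimes>\<^sub>M lborel))"
    by (simp add: lborel_prod)
  also have "\<dots> = (\<integral>\<^sup>+u. \<integral>\<^sup>+w. ennreal G * (v u * v w) \<partial>lborel \<partial>lborel)"
    by (subst lborel.nn_integral_fst[symmetric]) simp_all
  also have "\<dots> = ennreal G * (\<integral>\<^sup>+u. v u \<partial>lborel)\<^sup>2"
    by (simp add: nn_integral_cmult nn_integral_multc power2_eq_square)
  finally show ?thesis by (simp add: v)
qed

text \<open>
  Campbell's formulas for the sum of \<open>f\<close> over the points in \<open>W\<close>. The square of the sum splits into
  its diagonal, whose mean is \<open>A\<close>, and the sum over pairs of distinct points, whose mean lies between
  \<open>0\<close> and \<open>G * m^2\<close>. Subtracting the square of the mean \<open>m\<close> gives the bound on the variance.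
\<close>

lemma (in prob_space) linear_statistic_moments:
  fixes X :: "'a \<Rightarrow> 'b::euclidean_space set" and f lam :: "'b \<Rightarrow> real"
  assumes X [measurable]: "X \<in> M \<rightarrow>\<^sub>M config_space"
    and intensity: "is_intensity M X W lam" and density: "is_product_density2 M X W \<rho>"
    and W: "W \<in> sets borel" "bounded W"
    and lam: "\<And>u. u \<in> W \<Longrightarrow> 0 < lam u \<and> lam u \<le> K"
    and g: "\<And>u v. u \<in> W \<Longrightarrow> v \<in> W \<Longrightarrow> pair_correlation lam \<rho> u v \<le> G" and G: "0 \<le> G"
    and f [measurable]: "f \<in> borel_measurable borel" and f_nonneg: "\<And>u. 0 \<le> f u" and f_bound: "\<And>u. f u \<le> F"
  defines "S \<equiv> \<lambda>\<omega>. \<Sum>y\<in>X \<omega> \<inter> W. f y"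
    and "m \<equiv> LINT u|lborel. indicator W u * (f u * lam u)"
    and "A \<equiv> LINT u|lborel. indicator W u * ((f u)\<^sup>2 * lam u)"
  shows "S \<in> borel_measurable M" "integrable M (\<lambda>\<omega>. (S \<omega>)\<^sup>2)" "expectation S = m"
    "\<bar>variance S - A\<bar> \<le> (G + 1) * m\<^sup>2"
proof -
  define S2 where "S2 = (\<lambda>\<omega>. \<Sum>y\<in>X \<omega> \<inter> W. (f y)\<^sup>2)"
  have F: "F \<ge> 0" using f_nonneg[of 0] f_bound[of 0] by linarith
  have lamW: "set_borel_measurable borel W lam" using intensity by (simp add: is_intensity_def)
  have lam': "0 \<le> lam u \<and> lam u \<le> K" if "u \<in> W" for u using lam[OF that] by simp
  have f2_bound: "(f u)\<^sup>2 \<le> F\<^sup>2" for u using f_bound f_nonneg by (intro power_mono)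
  have fin: "finite (X \<omega> \<inter> W)" if "\<omega> \<in> space M" for \<omega>
    using finite_config_Int[OF measurable_space[OF X that] W(2)] .
  show S_meas [measurable]: "S \<in> borel_measurable M"
    unfolding S_def using f_nonneg W
    by (intro measurable_compose[OF X] measurable_config_sum) auto
  have S2_meas [measurable]: "S2 \<in> borel_measurable M"
    unfolding S2_def using W
    by (intro measurable_compose[OF X] measurable_config_sum) auto
  have nonneg: "0 \<le> S \<omega>" "0 \<le> S2 \<omega>" for \<omega>
    using f_nonneg by (auto simp: S_def S2_def intro!: sum_nonneg)
  have moment1: "(\<integral>\<^sup>+\<omega>. ennreal (\<Sum>y\<in>X \<omega> \<inter> W. \<phi> y) \<partial>M) = ennreal (LINT u|lborel. indicator W u * (\<phi> u * lam u))"
    if \<phi>: "\<phi> \<in> borel_measurable borel" "\<And>u. 0 \<le> \<phi> u" "\<And>u. \<phi> u \<le> F'" for \<phi> F'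
  proof -
    have "(\<integral>\<^sup>+\<omega>. ennreal (\<Sum>y\<in>X \<omega> \<inter> W. \<phi> y) \<partial>M) = factorial_moment1 M (\<lambda>\<omega>. X \<omega> \<inter> W) (\<lambda>y. ennreal (\<phi> y))"
      unfolding factorial_moment1_def using \<phi>(2) W(2)
      by (intro nn_integral_cong config_sum_eq_nn_integral[symmetric] measurable_space[OF X]) auto
    also have "\<dots> = (\<integral>\<^sup>+u\<in>W. ennreal (\<phi> u) * ennreal (lam u) \<partial>lborel)"
      using intensity \<phi>(1) by (simp add: is_intensity_def)
    also have "\<dots> = ennreal (LINT u|lborel. indicator W u * (\<phi> u * lam u))"
      by (rule nn_integral_intensity[OF lamW lam' W \<phi>])
    finally show ?thesis .
  qed
  have m_nonneg: "m \<ge> 0" unfolding m_def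
    using f_nonneg lam' by (intro integral_nonneg_AE always_eventually) (auto simp: indicator_def)
  have A_nonneg: "A \<ge> 0" unfolding A_def
    using lam' by (intro integral_nonneg_AE always_eventually) (auto simp: indicator_def)
  have ES: "(\<integral>\<^sup>+\<omega>. ennreal (S \<omega>) \<partial>M) = ennreal m"
    unfolding S_def m_def by (rule moment1[OF f f_nonneg f_bound])
  have ES2: "(\<integral>\<^sup>+\<omega>. ennreal (S2 \<omega>) \<partial>M) = ennreal A"
    unfolding S2_def A_def by (rule moment1[OF _ _ f2_bound]) auto
  define T where "T = factorial_moment2 M (\<lambda>\<omega>. X \<omega> \<inter> W) (\<lambda>p. ennreal (f (fst p)) * ennreal (f (snd p)))"
  have offdiag: "(\<integral>\<^sup>+p. ennreal (f (fst p)) * ennreal (f (snd p))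
        \<partial>count_space {(y, z). y \<in> X \<omega> \<inter> W \<and> z \<in> X \<omega> \<inter> W \<and> y \<noteq> z})
      = ennreal ((S \<omega>)\<^sup>2 - S2 \<omega>)" if "\<omega> \<in> space M" for \<omega>
  proof -
    let ?P = "{p. fst p \<in> X \<omega> \<inter> W \<and> snd p \<in> X \<omega> \<inter> W \<and> fst p \<noteq> snd p}"
    have "{(y, z). y \<in> X \<omega> \<inter> W \<and> z \<in> X \<omega> \<inter> W \<and> y \<noteq> z} = ?P" by auto
    moreover have "finite ?P"
      by (rule finite_subset[of _ "(X \<omega> \<inter> W) \<times> (X \<omega> \<inter> W)"]) (use fin[OF that] in auto)
    ultimately have "(\<integral>\<^sup>+p. ennreal (f (fst p)) * ennreal (f (snd p))
        \<partial>count_space {(y, z). y \<in> X \<omega> \<inter> W \<and> z \<in> X \<omega> \<inter> W \<and> y \<noteq> z})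
        = (\<Sum>p\<in>?P. ennreal (f (fst p) * f (snd p)))"
      using f_nonneg by (simp only: nn_integral_count_space_finite) (simp add: ennreal_mult)
    also have "\<dots> = ennreal (\<Sum>p\<in>?P. f (fst p) * f (snd p))"
      using f_nonneg by (intro sum_ennreal) auto
    also have "(\<Sum>p\<in>?P. f (fst p) * f (snd p)) = (S \<omega>)\<^sup>2 - S2 \<omega>"
      unfolding S_def S2_def by (simp add: sum_power2_eq_diagonal_plus_distinct[OF fin[OF that]])
    finally show ?thesis .
  qed
  have le: "S2 \<omega> \<le> (S \<omega>)\<^sup>2" if "\<omega> \<in> space M" for \<omega>
    unfolding S_def S2_def sum_power2_eq_diagonal_plus_distinct[OF fin[OF that]]
    using f_nonneg by (simp add: sum_nonneg)
  \<comment> \<open>Writing the off-diagonal sum as a difference of measurable variables makes it measurable.\<close>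
  have "T = (\<integral>\<^sup>+\<omega>. ennreal ((S \<omega>)\<^sup>2 - S2 \<omega>) \<partial>M)"
    unfolding T_def factorial_moment2_def by (intro nn_integral_cong offdiag)
  hence "ennreal A + T = (\<integral>\<^sup>+\<omega>. ennreal (S2 \<omega>) + ennreal ((S \<omega>)\<^sup>2 - S2 \<omega>) \<partial>M)"
    by (simp add: nn_integral_add ES2)
  also have "\<dots> = (\<integral>\<^sup>+\<omega>. ennreal ((S \<omega>)\<^sup>2) \<partial>M)"
    using le nonneg by (intro nn_integral_cong) (simp flip: ennreal_plus)
  finally have ESS: "(\<integral>\<^sup>+\<omega>. ennreal ((S \<omega>)\<^sup>2) \<partial>M) = ennreal A + T" by simp
  have "T = (\<integral>\<^sup>+p\<in>W \<times> W. (ennreal (f (fst p)) * ennreal (f (snd p))) * ennreal (\<rho> p) \<partial>lborel)"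
    unfolding T_def using density by (simp add: is_product_density2_def borel_prod[symmetric])
  also have "\<dots> \<le> ennreal G * (\<integral>\<^sup>+u\<in>W. ennreal (f u) * ennreal (lam u) \<partial>lborel)\<^sup>2"
    using lam by (intro second_moment_measure_bound lamW W f f_nonneg g G) auto
  also have "(\<integral>\<^sup>+u\<in>W. ennreal (f u) * ennreal (lam u) \<partial>lborel) = ennreal m"
    unfolding m_def by (rule nn_integral_intensity[OF lamW lam' W f f_nonneg f_bound])
  also have "ennreal G * (ennreal m)\<^sup>2 = ennreal (G * m\<^sup>2)"
    using m_nonneg G by (simp add: ennreal_mult ennreal_power)
  finally have T_le: "T \<le> ennreal (G * m\<^sup>2)" .
  define B where "B = enn2real T"
  have T: "T = ennreal B" unfolding B_def
    by (rule ennreal_enn2real[symmetric]) (rule le_less_trans[OF T_le ennreal_less_top])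
  have B: "0 \<le> B" "B \<le> G * m\<^sup>2"
    using T_le G unfolding T by (auto simp: B_def ennreal_le_iff)
  have ESS': "(\<integral>\<^sup>+\<omega>. ennreal ((S \<omega>)\<^sup>2) \<partial>M) = ennreal (A + B)"
    unfolding ESS T using A_nonneg B by simp
  show int2: "integrable M (\<lambda>\<omega>. (S \<omega>)\<^sup>2)"
    by (rule integrableI_nonneg) (auto simp: ESS')
  have int1: "integrable M S"
    by (rule integrableI_nonneg) (auto simp: ES nonneg)
  show ex: "expectation S = m"
    using m_nonneg nonneg by (subst integral_eq_nn_integral) (auto simp: ES)
  have "expectation (\<lambda>\<omega>. (S \<omega>)\<^sup>2) = A + B"
    using A_nonneg B by (subst integral_eq_nn_integral) (auto simp: ESS' simp del: ennreal_plus)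
  hence var: "variance S = A + B - m\<^sup>2"
    using variance_eq[OF int1 int2] ex by simp
  have "(G + 1) * m\<^sup>2 = G * m\<^sup>2 + m\<^sup>2" by (simp add: algebra_simps)
  thus "\<bar>variance S - A\<bar> \<le> (G + 1) * m\<^sup>2"
    unfolding var using B zero_le_power2[of m] by linarith
qed

lemma (in prob_space) indep_variance_add:
  fixes X Y :: "'a \<Rightarrow> real"
  assumes indep: "indep_var borel X borel Y"
    and int: "integrable M X" "integrable M Y" "integrable M (\<lambda>\<omega>. (X \<omega>)\<^sup>2)" "integrable M (\<lambda>\<omega>. (Y \<omega>)\<^sup>2)"
  shows "integrable M (\<lambda>\<omega>. (X \<omega> + Y \<omega>)\<^sup>2)"
    and "variance (\<lambda>\<omega>. X \<omega> + Y \<omega>) = variance X + variance Y"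
proof -
  have XY: "integrable M (\<lambda>\<omega>. X \<omega> * Y \<omega>)"
    "expectation (\<lambda>\<omega>. X \<omega> * Y \<omega>) = expectation X * expectation Y"
    using indep_var_integrable[OF indep int(1,2)] indep_var_lebesgue_integral[OF indep int(1,2)] by auto
  have sq: "(\<lambda>\<omega>. (X \<omega> + Y \<omega>)\<^sup>2) = (\<lambda>\<omega>. (X \<omega>)\<^sup>2 + (Y \<omega>)\<^sup>2 + 2 * (X \<omega> * Y \<omega>))"
    by (simp add: fun_eq_iff power2_sum)
  show int_sum: "integrable M (\<lambda>\<omega>. (X \<omega> + Y \<omega>)\<^sup>2)"
    unfolding sq using int XY by simp
  have "expectation (\<lambda>\<omega>. (X \<omega> + Y \<omega>)\<^sup>2) = expectation (\<lambda>\<omega>. (X \<omega>)\<^sup>2) + expectation (\<lambda>\<omega>. (Y \<omega>)\<^sup>2)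
      + 2 * (expectation X * expectation Y)"
    unfolding sq using int XY by simp
  moreover have "integrable M (\<lambda>\<omega>. X \<omega> + Y \<omega>)" using int by simp
  ultimately show "variance (\<lambda>\<omega>. X \<omega> + Y \<omega>) = variance X + variance Y"
    using int unfolding variance_eq[OF int(1,3)] variance_eq[OF int(2,4)]
    by (subst variance_eq) (simp_all only: int_sum, simp_all add: power2_sum)
qed

lemma (in prob_space) indep_vars_variance_sum:
  fixes X :: "'i \<Rightarrow> 'a \<Rightarrow> real"
  assumes "finite I" "indep_vars (\<lambda>_. borel) X I"
    and "\<And>i. i \<in> I \<Longrightarrow> integrable M (X i)" "\<And>i. i \<in> I \<Longrightarrow> integrable M (\<lambda>\<omega>. (X i \<omega>)\<^sup>2)"
  shows "integrable M (\<lambda>\<omega>. (\<Sum>i\<in>I. X i \<omega>)\<^sup>2) \<and>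
    variance (\<lambda>\<omega>. \<Sum>i\<in>I. X i \<omega>) = (\<Sum>i\<in>I. variance (X i))"
  using assms
proof (induction I rule: finite_induct)
  case empty
  show ?case by simp
next
  case (insert i I)
  have IH: "integrable M (\<lambda>\<omega>. (\<Sum>i\<in>I. X i \<omega>)\<^sup>2) \<and>
    variance (\<lambda>\<omega>. \<Sum>i\<in>I. X i \<omega>) = (\<Sum>i\<in>I. variance (X i))"
    using insert.prems by (intro insert.IH indep_vars_subset[OF insert.prems(1)]) auto
  have indep: "indep_var borel (X i) borel (\<lambda>\<omega>. \<Sum>i\<in>I. X i \<omega>)"
    by (rule indep_vars_sum[OF insert.hyps insert.prems(1)])
  have "integrable M (\<lambda>\<omega>. \<Sum>i\<in>I. X i \<omega>)" using insert.prems by auto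
  from indep_variance_add[OF indep _ this] show ?case
    using IH insert.prems insert.hyps by simp
qed

lemma (in prob_space) indep_vars_average_moments:
  fixes X :: "nat \<Rightarrow> 'a \<Rightarrow> real"
  assumes n: "n \<ge> 1" and indep: "indep_vars (\<lambda>_. borel) X {1..n}"
    and sq: "\<And>i. i \<in> {1..n} \<Longrightarrow> integrable M (\<lambda>\<omega>. (X i \<omega>)\<^sup>2)"
    and m: "\<And>i. i \<in> {1..n} \<Longrightarrow> expectation (X i) = m"
    and v: "\<And>i. i \<in> {1..n} \<Longrightarrow> variance (X i) = v"
  shows "expectation (\<lambda>\<omega>. 1 / real n * (\<Sum>i=1..n. X i \<omega>)) = m"
    and "variance (\<lambda>\<omega>. 1 / real n * (\<Sum>i=1..n. X i \<omega>)) = v / real n"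
proof -
  have int: "integrable M (X i)" if "i \<in> {1..n}" for i
  proof (rule square_integrable_imp_integrable[OF _ sq[OF that]])
    show "X i \<in> borel_measurable M" using indep that unfolding indep_vars_def by blast
  qed
  have "expectation (\<lambda>\<omega>. 1 / real n * (\<Sum>i=1..n. X i \<omega>)) = 1 / real n * (\<Sum>i=1..n. expectation (X i))"
    using int by simp
  also have "\<dots> = m" using m n by simp
  finally show "expectation (\<lambda>\<omega>. 1 / real n * (\<Sum>i=1..n. X i \<omega>)) = m" .
  define S where "S = (\<lambda>\<omega>. \<Sum>i=1..n. X i \<omega>)"
  have scale: "expectation (\<lambda>\<omega>. 1 / real n * S \<omega>) = 1 / real n * expectation S"
    by (rule integral_mult_right_zero)
  have "(1 / real n * S \<omega> - 1 / real n * expectation S)\<^sup>2 = (1 / real n)\<^sup>2 * (S \<omega> - expectation S)\<^sup>2" for \<omega>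
    by (simp only: power_mult_distrib right_diff_distrib[symmetric])
  hence "variance (\<lambda>\<omega>. 1 / real n * S \<omega>) = (1 / real n)\<^sup>2 * variance S"
    unfolding scale by (simp only: integral_mult_right_zero)
  also have "variance S = (\<Sum>i=1..n. variance (X i))"
    unfolding S_def
    using indep_vars_variance_sum[OF _ indep] int sq by auto
  also have "\<dots> = real n * v" using v by simp
  finally show "variance (\<lambda>\<omega>. 1 / real n * (\<Sum>i=1..n. X i \<omega>)) = v / real n"
    using n unfolding S_def by (simp add: power2_eq_square field_simps)
qed

section \<open>The Beta kernel and the summands of the estimator\<close>

lemma beta_kernel_eq:
  "beta_kernel \<gamma> (x :: real ^ 'n::finite) = profile 0 \<gamma> (x \<bullet> x) 1 / beta_const TYPE('n) \<gamma>"
proof -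
  have "x \<in> cball 0 1 \<longleftrightarrow> x \<bullet> x \<le> 1" by (simp add: norm_eq_sqrt_inner)
  thus ?thesis
    by (auto simp: beta_kernel_def profile_def max_def indicator_def field_simps)
qed

text \<open>
  Identifies the integral of the undilated profile with the normalising constant of the kernel,
  whatever power of the weight the profile carries.
\<close>

lemma beta_const_eq:
  "beta_const TYPE('n::finite) \<gamma> = (LINT x::real ^ 'n|lborel. profile p \<gamma> (x \<bullet> x) 1)"
  unfolding beta_const_def set_lebesgue_integral_def
proof (intro Bochner_Integration.integral_cong refl)
  fix x :: "real ^ 'n"
  have "x \<in> cball 0 1 \<longleftrightarrow> x \<bullet> x \<le> 1" by (simp add: norm_eq_sqrt_inner)
  thus "indicator (cball 0 1) x *\<^sub>R (1 - x \<bullet> x) powr \<gamma> = profile p \<gamma> (x \<bullet> x) 1"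
    by (auto simp: profile_def max_def indicator_def)
qed

lemma beta_const_pos:
  assumes "\<gamma> > 0"
  shows "beta_const TYPE('n::finite) \<gamma> > 0"
proof -
  \<comment> \<open>On the ball of radius 1/2 the integrand is at least (1 - 1/4) powr the exponent.\<close>
  let ?I = "indicator (cball (0 :: real ^ 'n) (1/2)) :: real ^ 'n \<Rightarrow> real"
  have pos: "0 \<le> profile 0 \<gamma> (x \<bullet> x) 1" for x :: "real ^ 'n" by (simp add: profile_def)
  have "integrable lborel (\<lambda>x::real ^ 'n. profile 0 \<gamma> (x \<bullet> x) 1)"
  proof (rule integrable_on_cball)
    fix x :: "real ^ 'n"
    have "max 0 (1 - x \<bullet> x) powr \<gamma> \<le> 1" using assms by (intro powr_le1) auto
    thus "\<bar>profile 0 \<gamma> (x \<bullet> x) 1\<bar> \<le> 1 * indicator (cball 0 1) x"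
      by (cases "x \<in> cball 0 1") (auto simp: profile_def norm_eq_sqrt_inner max_def)
  qed measurable
  hence "(LINT x|lborel. (3/4) powr \<gamma> * ?I x) \<le> (LINT x::real ^ 'n|lborel. profile 0 \<gamma> (x \<bullet> x) 1)"
  proof (rule integral_mono[rotated])
    show "integrable lborel (\<lambda>x. (3/4) powr \<gamma> * ?I x)"
      by (intro integrable_mult_right integrable_indicator_cball)
    fix x :: "real ^ 'n"
    show "(3/4) powr \<gamma> * ?I x \<le> profile 0 \<gamma> (x \<bullet> x) 1"
    proof (cases "x \<in> cball 0 (1/2)")
      case True
      hence "(norm x)\<^sup>2 \<le> (1/2)\<^sup>2" by (intro power_mono) auto
      hence "x \<bullet> x \<le> (1/2)\<^sup>2" by (simp only: power2_norm_eq_inner)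
      hence "x \<bullet> x \<le> 1/4" by (simp add: power2_eq_square)
      hence "(3/4) powr \<gamma> \<le> max 0 (1 - x \<bullet> x) powr \<gamma>"
        using assms by (intro powr_mono2) auto
      thus ?thesis using True by (simp add: profile_def)
    qed (simp add: pos)
  qed
  moreover have "measure lborel (cball (0 :: real ^ 'n) (1/2)) > 0"
    using content_cball_pos[of "1/2" "0 :: real ^ 'n"] by simp
  hence "(LINT x|lborel. (3/4) powr \<gamma> * ?I x) > 0" by simp
  ultimately show ?thesis unfolding beta_const_eq[of \<gamma> 0] by linarith
qed

lemma beta_Q_eq:
  "beta_Q TYPE('n::finite) \<gamma>
     = (LINT x::real ^ 'n|lborel. profile p (2 * \<gamma>) (x \<bullet> x) 1) / (beta_const TYPE('n) \<gamma>)\<^sup>2"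
proof -
  have "(beta_kernel \<gamma> x)\<^sup>2 = profile p (2 * \<gamma>) (x \<bullet> x) 1 / (beta_const TYPE('n) \<gamma>)\<^sup>2" for x :: "real ^ 'n"
  proof -
    have "(profile 0 \<gamma> (x \<bullet> x) 1)\<^sup>2 = profile p (2 * \<gamma>) (x \<bullet> x) 1"
      by (simp add: profile_def power2_eq_square flip: powr_add)
    thus ?thesis by (simp add: beta_kernel_eq power_divide)
  qed
  thus ?thesis unfolding beta_Q_def by simp
qed

definition kernel_summand :: "(real ^ 'n::finite \<Rightarrow> real) \<Rightarrow> real \<Rightarrow> real ^ 'n \<Rightarrow> real \<Rightarrow> real ^ 'n \<Rightarrow> real" where
  "kernel_summand lam \<gamma> x0 h y = abramson_weight lam x0 y ^ CARD('n) / h ^ CARD('n) *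
     beta_kernel \<gamma> (abramson_weight lam x0 y *\<^sub>R ((x0 - y) /\<^sub>R h))"

lemma measurable_kernel_summand:
  fixes lam :: "real ^ 'n::finite \<Rightarrow> real"
  assumes [measurable]: "lam \<in> borel_measurable borel"
  shows "kernel_summand lam \<gamma> x0 h \<in> borel_measurable borel"
  unfolding kernel_summand_def[abs_def] abramson_weight_def beta_kernel_eq by measurable

lemma kernel_summand_nonneg:
  fixes lam :: "real ^ 'n::finite \<Rightarrow> real"
  assumes "\<gamma> > 0" "h > 0" "\<And>u. 0 \<le> lam u"
  shows "0 \<le> kernel_summand lam \<gamma> x0 h y"
  unfolding kernel_summand_def abramson_weight_def beta_kernel_eq profile_def
  using assms beta_const_pos[OF assms(1), where 'n = 'n]
  by (auto intro!: mult_nonneg_nonneg divide_nonneg_nonneg zero_le_power)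

lemma kernel_summand_bound:
  fixes lam :: "real ^ 'n::finite \<Rightarrow> real"
  assumes "\<gamma> > 0" "h > 0" "\<And>u. 0 \<le> lam u" "\<And>u. lam u \<le> K" "lam x0 > 0"
  shows "kernel_summand lam \<gamma> x0 h y
    \<le> sqrt (K / lam x0) ^ CARD('n) / h ^ CARD('n) * (1 / beta_const TYPE('n) \<gamma>)"
  unfolding kernel_summand_def
proof (intro mult_mono divide_right_mono power_mono)
  show "abramson_weight lam x0 y \<le> sqrt (K / lam x0)"
    using assms by (simp add: abramson_weight_def divide_right_mono)
  show "beta_kernel \<gamma> z \<le> 1 / beta_const TYPE('n) \<gamma>" for z :: "real ^ 'n"
    unfolding beta_kernel_eq profile_def using assms beta_const_pos[OF assms(1), where 'n = 'n]
    by (intro divide_right_mono) (auto intro!: powr_le1)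
  show "0 \<le> beta_kernel \<gamma> z" for z :: "real ^ 'n"
    unfolding beta_kernel_eq profile_def using beta_const_pos[OF assms(1), where 'n = 'n] by simp
  have "0 \<le> K" using assms(3,4)[of 0] by linarith
  thus "0 \<le> sqrt (K / lam x0) ^ CARD('n) / h ^ CARD('n)" using assms by simp
  show "0 \<le> abramson_weight lam x0 y" using assms by (simp add: abramson_weight_def)
qed (use assms in auto)

text \<open>
  In the scaled variable \<open>u\<close> a summand times the intensity is a profile in the relative intensity.
  The exponent is \<open>d/2\<close> from the weight plus \<open>1\<close> from the intensity, and \<open>d + 1\<close> with shape
  parameter \<open>2 * \<gamma>\<close> if the summand is squared.
\<close>

lemma kernel_summand_dilation:
  fixes lam :: "real ^ 'n::finite \<Rightarrow> real"
  assumes h: "h > 0" and lam: "\<And>u. 0 \<le> lam u" "lam x0 > 0"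
  defines "t \<equiv> \<lambda>u. lam (x0 + h *\<^sub>R u) / lam x0"
  shows "kernel_summand lam \<gamma> x0 h (x0 + h *\<^sub>R u) * lam (x0 + h *\<^sub>R u)
      = lam x0 / (beta_const TYPE('n) \<gamma> * h ^ CARD('n)) * profile (CARD('n) / 2 + 1) \<gamma> (u \<bullet> u) (t u)"
    and "(kernel_summand lam \<gamma> x0 h (x0 + h *\<^sub>R u))\<^sup>2 * lam (x0 + h *\<^sub>R u)
      = lam x0 / (beta_const TYPE('n) \<gamma> * h ^ CARD('n))\<^sup>2 * profile (CARD('n) + 1) (2 * \<gamma>) (u \<bullet> u) (t u)"
proof -
  have t0: "t u \<ge> 0" using lam by (simp add: t_def)
  have lam_t: "lam (x0 + h *\<^sub>R u) = lam x0 * t u" using lam by (simp add: t_def)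
  have kernel: "kernel_summand lam \<gamma> x0 h (x0 + h *\<^sub>R u)
      = sqrt (t u) ^ CARD('n) / h ^ CARD('n) * (max 0 (1 - t u * (u \<bullet> u)) powr \<gamma> / beta_const TYPE('n) \<gamma>)"
  proof -
    have 1: "(x0 - (x0 + h *\<^sub>R u)) /\<^sub>R h = - u" using h by simp
    have 2: "sqrt (t u) * (sqrt (t u) * (u \<bullet> u)) = t u * (u \<bullet> u)"
      using t0 by (simp flip: mult.assoc)
    have 3: "abramson_weight lam x0 (x0 + h *\<^sub>R u) = sqrt (t u)"
      by (simp add: abramson_weight_def t_def)
    show ?thesis unfolding kernel_summand_def beta_kernel_eq 3 1 by (simp add: profile_def 2)
  qed
  have p1: "sqrt (t u) ^ CARD('n) * t u = t u powr (CARD('n) / 2 + 1)"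
    and p2: "(sqrt (t u) ^ CARD('n))\<^sup>2 * t u = t u powr (CARD('n) + 1)"
  proof -
    consider "t u = 0" | "t u > 0" using t0 by linarith
    hence "sqrt (t u) ^ CARD('n) * t u = t u powr (CARD('n) / 2 + 1) \<and>
      (sqrt (t u) ^ CARD('n))\<^sup>2 * t u = t u powr (CARD('n) + 1)"
    proof cases
      case 2
      have "sqrt (t u) ^ CARD('n) = t u powr (CARD('n) / 2)"
        using 2 by (simp add: powr_powr flip: powr_half_sqrt powr_realpow)
      moreover have "(t u powr (CARD('n) / 2))\<^sup>2 = t u powr CARD('n)"
        by (simp add: power2_eq_square flip: powr_add)
      ultimately show ?thesis using 2 by (simp add: powr_add)
    qed simp
    thus "sqrt (t u) ^ CARD('n) * t u = t u powr (CARD('n) / 2 + 1)"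
      "(sqrt (t u) ^ CARD('n))\<^sup>2 * t u = t u powr (CARD('n) + 1)" by blast+
  qed
  show "kernel_summand lam \<gamma> x0 h (x0 + h *\<^sub>R u) * lam (x0 + h *\<^sub>R u)
      = lam x0 / (beta_const TYPE('n) \<gamma> * h ^ CARD('n)) * profile (CARD('n) / 2 + 1) \<gamma> (u \<bullet> u) (t u)"
    unfolding kernel lam_t profile_def by (simp add: mult_ac flip: p1)
  have p3: "(max 0 (1 - t u * (u \<bullet> u)) powr \<gamma>)\<^sup>2 = max 0 (1 - t u * (u \<bullet> u)) powr (2 * \<gamma>)"
    by (simp add: power2_eq_square flip: powr_add)
  show "(kernel_summand lam \<gamma> x0 h (x0 + h *\<^sub>R u))\<^sup>2 * lam (x0 + h *\<^sub>R u)
      = lam x0 / (beta_const TYPE('n) \<gamma> * h ^ CARD('n))\<^sup>2 * profile (CARD('n) + 1) (2 * \<gamma>) (u \<bullet> u) (t u)"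
    unfolding kernel lam_t profile_def p3[symmetric] p2[symmetric]
    by (simp add: power_mult_distrib power_divide mult_ac)
qed

lemma kernel_summand_integrals:
  fixes lam :: "real ^ 'n::finite \<Rightarrow> real"
  assumes h: "h > 0" and lam: "\<And>u. 0 \<le> lam u" "lam x0 > 0"
    and [measurable]: "lam \<in> borel_measurable borel"
  defines "t \<equiv> \<lambda>u. lam (x0 + h *\<^sub>R u) / lam x0"
  shows "(LINT y|lborel. kernel_summand lam \<gamma> x0 h y * lam y)
      = lam x0 / beta_const TYPE('n) \<gamma> * (LINT u|lborel. profile (CARD('n) / 2 + 1) \<gamma> (u \<bullet> u) (t u))"
    and "(LINT y|lborel. (kernel_summand lam \<gamma> x0 h y)\<^sup>2 * lam y)
      = lam x0 / ((beta_const TYPE('n) \<gamma>)\<^sup>2 * h ^ CARD('n)) *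
          (LINT u|lborel. profile (CARD('n) + 1) (2 * \<gamma>) (u \<bullet> u) (t u))"
proof -
  have [measurable]: "kernel_summand lam \<gamma> x0 h \<in> borel_measurable borel"
    by (rule measurable_kernel_summand) measurable
  have "(LINT y|lborel. kernel_summand lam \<gamma> x0 h y * lam y) = \<bar>h\<bar> ^ DIM(real ^ 'n) *
      (LINT u|lborel. kernel_summand lam \<gamma> x0 h (x0 + h *\<^sub>R u) * lam (x0 + h *\<^sub>R u))"
    by (rule lborel_integral_affine) (use h in auto)
  also have "\<dots> = h ^ CARD('n) * (lam x0 / (beta_const TYPE('n) \<gamma> * h ^ CARD('n)) *
      (LINT u|lborel. profile (CARD('n) / 2 + 1) \<gamma> (u \<bullet> u) (t u)))"
    unfolding kernel_summand_dilation(1)[of h lam x0, OF h lam] t_def using h by simp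
  finally show "(LINT y|lborel. kernel_summand lam \<gamma> x0 h y * lam y)
      = lam x0 / beta_const TYPE('n) \<gamma> * (LINT u|lborel. profile (CARD('n) / 2 + 1) \<gamma> (u \<bullet> u) (t u))"
    using h by (simp add: field_simps)
  have "(LINT y|lborel. (kernel_summand lam \<gamma> x0 h y)\<^sup>2 * lam y) = \<bar>h\<bar> ^ DIM(real ^ 'n) *
      (LINT u|lborel. (kernel_summand lam \<gamma> x0 h (x0 + h *\<^sub>R u))\<^sup>2 * lam (x0 + h *\<^sub>R u))"
    by (rule lborel_integral_affine) (use h in auto)
  also have "\<dots> = h ^ CARD('n) * (lam x0 / (beta_const TYPE('n) \<gamma> * h ^ CARD('n))\<^sup>2 *
      (LINT u|lborel. profile (CARD('n) + 1) (2 * \<gamma>) (u \<bullet> u) (t u)))"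
    unfolding kernel_summand_dilation(2)[of h lam x0, OF h lam] t_def using h by simp
  finally show "(LINT y|lborel. (kernel_summand lam \<gamma> x0 h y)\<^sup>2 * lam y)
      = lam x0 / ((beta_const TYPE('n) \<gamma>)\<^sup>2 * h ^ CARD('n)) *
          (LINT u|lborel. profile (CARD('n) + 1) (2 * \<gamma>) (u \<bullet> u) (t u))"
    using h by (simp add: power_mult_distrib power2_eq_square)
qed

text \<open>
  Extending the intensity by zero outside \<open>W\<close> makes the relative intensity a Borel function on the
  whole space and cuts off the points outside \<open>W\<close>; on a fixed ball in \<open>u\<close> the extension eventually
  agrees with the intensity, because \<open>x0\<close> is an interior point.
\<close>

lemma dilation_sequence_intensity:
  fixes lam :: "real ^ 'n::finite \<Rightarrow> real"
  assumes W: "open W" and x0: "x0 \<in> W"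
    and C2: "C2_on W lam" and hess: "\<And>i j. bounded (partial_deriv i (partial_deriv j lam) ` W)"
    and lo: "0 < lam_lo" and lam: "\<And>x. x \<in> W \<Longrightarrow> lam x \<in> {lam_lo<..<lam_hi}"
    and meas: "set_borel_measurable borel W lam"
    and h0: "h \<longlonglongrightarrow> 0" and h_pos: "\<forall>\<^sub>F n in sequentially. h n > 0"
  shows "\<exists>R C. dilation_sequence (\<lambda>n u. (indicator W (x0 + h n *\<^sub>R u) * lam (x0 + h n *\<^sub>R u)) / lam x0) h
    (\<lambda>u. gradient_form lam x0 u / lam x0) (\<lambda>u. hessian_form lam x0 u / (2 * lam x0))
    (lam_lo / lam x0) (lam_hi / lam x0) R C"
proof -
  \<comment> \<open>Beyond this radius even the infimum of the weights moves the argument out of the unit ball.\<close>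
  define R where "R = sqrt (lam x0 / lam_lo)"
  have l0: "lam_lo < lam x0" "lam x0 < lam_hi" "0 < lam x0" using lam[OF x0] lo by auto
  have R: "R \<ge> 1" "lam_lo / lam x0 * R\<^sup>2 = 1" using l0 lo by (auto simp: R_def)
  obtain B where B: "B > 0" "\<And>x u. x \<in> W \<Longrightarrow> norm u \<le> R \<Longrightarrow> \<bar>hessian_form lam x u\<bar> \<le> B"
    using hessian_form_bound[OF hess, of R] by metis
  obtain \<delta> where \<delta>: "\<delta> > 0" "ball x0 \<delta> \<subseteq> W" using W x0 by (meson open_contains_ball)
  have "(\<lambda>n. h n * R) \<longlonglongrightarrow> 0 * R" by (intro tendsto_intros h0)
  hence "\<forall>\<^sub>F n in sequentially. h n * R < \<delta>" using \<delta>(1) by (intro order_tendstoD) auto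
  hence seg: "\<forall>\<^sub>F n in sequentially. \<forall>u. norm u \<le> R \<longrightarrow> (\<forall>s. 0 \<le> s \<longrightarrow> s \<le> h n \<longrightarrow> x0 + s *\<^sub>R u \<in> W)"
  proof eventually_elim
    case (elim n)
    show ?case
    proof (intro allI impI)
      fix u :: "real ^ 'n" and s assume "norm u \<le> R" "0 \<le> s" "s \<le> h n"
      hence "s * norm u \<le> h n * R" using R by (intro mult_mono) auto
      with elim \<open>0 \<le> s\<close> have "x0 + s *\<^sub>R u \<in> ball x0 \<delta>" by (simp add: dist_norm)
      thus "x0 + s *\<^sub>R u \<in> W" using \<delta>(2) by blast
    qed
  qed
  have [measurable]: "(\<lambda>x. indicator W x * lam x) \<in> borel_measurable borel"
    using meas by (simp add: set_borel_measurable_def)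
  define t where "t = (\<lambda>n u. (indicator W (x0 + h n *\<^sub>R u) * lam (x0 + h n *\<^sub>R u)) / lam x0)"
  define L where "L = (\<lambda>u. gradient_form lam x0 u / lam x0)"
  define q where "q = (\<lambda>u. hessian_form lam x0 u / (2 * lam x0))"
  have "dilation_sequence t h L q (lam_lo / lam x0) (lam_hi / lam x0) R (B / (2 * lam x0))"
  proof (rule dilation_sequence.intro)
    show "t n \<in> borel_measurable borel" for n
    proof -
      have "(\<lambda>u. x0 + h n *\<^sub>R u) \<in> borel \<rightarrow>\<^sub>M borel" by measurable
      from measurable_compose[OF this, of "\<lambda>x. indicator W x * lam x" borel]
      show ?thesis unfolding t_def by measurable
    qed
    have "continuous_on UNIV q" unfolding q_def using l0
      by (intro continuous_intros continuous_hessian_form) auto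
    thus "q \<in> borel_measurable borel" by (rule borel_measurable_continuous_onI)
    have "bounded_linear (\<lambda>u. (1 / lam x0) * gradient_form lam x0 u)"
      by (intro bounded_linear_const_mult bounded_linear_gradient_form)
    thus "bounded_linear L" by (simp add: L_def)
    show "q (c *\<^sub>R u) = c\<^sup>2 * q u" for c u by (simp add: q_def hessian_form_scaleR)
    show "\<bar>q u\<bar> \<le> B / (2 * lam x0)" if "norm u \<le> R" for u
      using B(2)[OF x0 that] l0 by (simp add: q_def divide_right_mono)
    show "0 < lam_lo / lam x0" "lam_lo / lam x0 \<le> 1" "1 \<le> lam_hi / lam x0" "1 \<le> R"
      "1 \<le> lam_lo / lam x0 * R\<^sup>2"
      using l0 lo R by auto
    show "t n u = 0 \<or> lam_lo / lam x0 \<le> t n u" for n u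
      using lam[of "x0 + h n *\<^sub>R u"] l0 by (auto simp: t_def indicator_def divide_right_mono)
    show "\<forall>\<^sub>F n in sequentially. \<forall>u. norm u \<le> R \<longrightarrow> lam_lo / lam x0 \<le> t n u \<and> t n u \<le> lam_hi / lam x0"
      using seg h_pos
    proof eventually_elim
      case (elim n)
      show ?case
      proof (intro allI impI)
        fix u :: "real ^ 'n" assume "norm u \<le> R"
        hence "x0 + h n *\<^sub>R u \<in> W" using elim by auto
        thus "lam_lo / lam x0 \<le> t n u \<and> t n u \<le> lam_hi / lam x0"
          using lam[of "x0 + h n *\<^sub>R u"] l0 by (auto simp: t_def divide_right_mono)
      qed
    qed
    have t_eq: "t n u - 1 - h n * L u = (lam (x0 + h n *\<^sub>R u) - lam x0 - h n * gradient_form lam x0 u) / lam x0"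
      if "x0 + h n *\<^sub>R u \<in> W" for n u
      using that l0 by (simp add: t_def L_def field_simps)
    show "\<forall>\<^sub>F n in sequentially. \<forall>u. norm u \<le> R \<longrightarrow> \<bar>t n u - 1 - h n * L u\<bar> \<le> B / (2 * lam x0) * (h n)\<^sup>2"
      using seg h_pos
    proof eventually_elim
      case (elim n)
      show ?case
      proof (intro allI impI)
        fix u :: "real ^ 'n" assume u: "norm u \<le> R"
        have W': "x0 + s *\<^sub>R u \<in> W" if "0 \<le> s" "s \<le> h n" for s using elim u that by blast
        obtain \<xi> where \<xi>: "0 \<le> \<xi>" "\<xi> \<le> h n" "lam (x0 + h n *\<^sub>R u) = lam x0 + h n * gradient_form lam x0 u
            + hessian_form lam (x0 + \<xi> *\<^sub>R u) u / 2 * (h n)\<^sup>2"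
          using C2_taylor_segment[OF C2 W W' less_imp_le[OF elim(2)]] by blast
        have "t n u - 1 - h n * L u = hessian_form lam (x0 + \<xi> *\<^sub>R u) u * ((h n)\<^sup>2 / (2 * lam x0))"
          using t_eq[of n u] W'[of "h n"] elim \<xi>(3) by simp
        also have "\<bar>\<dots>\<bar> \<le> B * ((h n)\<^sup>2 / (2 * lam x0))"
          unfolding abs_mult using B(2)[OF W'[OF \<xi>(1,2)] u] B(1) l0 by (intro mult_mono) auto
        finally show "\<bar>t n u - 1 - h n * L u\<bar> \<le> B / (2 * lam x0) * (h n)\<^sup>2" by simp
      qed
    qed
    fix u :: "real ^ 'n" assume u: "norm u \<le> R"
    have seg': "\<forall>\<^sub>F n in sequentially. \<forall>s. 0 \<le> s \<longrightarrow> s \<le> h n \<longrightarrow> x0 + s *\<^sub>R u \<in> W"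
      using seg by eventually_elim (use u in blast)
    have "(\<lambda>n. (lam (x0 + h n *\<^sub>R u) - lam x0 - h n * gradient_form lam x0 u) / (h n)\<^sup>2 / lam x0)
        \<longlonglongrightarrow> hessian_form lam x0 u / 2 / lam x0"
      using l0 by (intro tendsto_divide tendsto_const C2_taylor_limit[OF C2 W seg' h0 h_pos x0]) auto
    moreover have "\<forall>\<^sub>F n in sequentially.
        (lam (x0 + h n *\<^sub>R u) - lam x0 - h n * gradient_form lam x0 u) / (h n)\<^sup>2 / lam x0
        = (t n u - 1 - h n * L u) / (h n)\<^sup>2"
      using seg' h_pos
    proof eventually_elim
      case (elim n)
      hence "x0 + h n *\<^sub>R u \<in> W" by auto
      thus ?case by (simp add: t_eq)
    qed
    ultimately show "(\<lambda>n. (t n u - 1 - h n * L u) / (h n)\<^sup>2) \<longlonglongrightarrow> q u"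
      by (auto simp: q_def intro: Lim_transform_eventually)
  qed (use h0 h_pos in auto)
  thus ?thesis unfolding t_def L_def q_def by blast
qed

section \<open>Mean and variance of the adaptive estimator\<close>

text \<open>
  Each process contributes the same measurable functional of its configuration, so the contributions
  are independent and share mean and variance; \<open>linear_statistic_moments\<close> need only be applied to the
  first process. With the intensity extended by zero the weight, hence the summand, vanishes
  outside \<open>W\<close>.
\<close>

lemma (in prob_space) adaptive_estimator_moments:
  fixes \<Phi> :: "nat \<Rightarrow> 'a \<Rightarrow> (real ^ 'n::finite) set" and lam :: "real ^ 'n \<Rightarrow> real"
  assumes iid: "iid_point_processes M \<Phi>"
    and intensity: "is_intensity M (\<Phi> 1) W lam" and density: "is_product_density2 M (\<Phi> 1) W \<rho>"
    and W: "W \<in> sets borel" "bounded W" and x0: "x0 \<in> W"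
    and lam: "\<And>u. u \<in> W \<Longrightarrow> 0 < lam u \<and> lam u \<le> K"
    and g: "\<And>u v. u \<in> W \<Longrightarrow> v \<in> W \<Longrightarrow> pair_correlation lam \<rho> u v \<le> G" and G: "0 \<le> G"
    and \<gamma>: "\<gamma> > 0" and n: "n \<ge> 1" and h: "h n > 0"
  defines "lamW \<equiv> \<lambda>u. indicator W u * lam u"
  defines "m \<equiv> LINT y|lborel. kernel_summand lamW \<gamma> x0 (h n) y * lamW y"
    and "A \<equiv> LINT y|lborel. (kernel_summand lamW \<gamma> x0 (h n) y)\<^sup>2 * lamW y"
  shows "expectation (adaptive_estimator \<Phi> W lam \<gamma> h x0 n) = m"
    and "\<bar>variance (adaptive_estimator \<Phi> W lam \<gamma> h x0 n) - A / real n\<bar> \<le> (G + 1) * m\<^sup>2 / real n"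
proof -
  define f where "f = kernel_summand lamW \<gamma> x0 (h n)"
  define S where "S = (\<lambda>\<phi>. \<Sum>y\<in>\<phi> \<inter> W. f y)"
  have lamW_meas: "lamW \<in> borel_measurable borel"
    using intensity unfolding lamW_def is_intensity_def set_borel_measurable_def by simp
  have K: "0 \<le> K" using lam[OF x0] by linarith
  have lamW: "0 \<le> lamW u" "lamW u \<le> K" for u
    using lam[of u] K by (auto simp: lamW_def indicator_def)
  have lamW_x0: "lamW x0 = lam x0" "lamW x0 > 0" using x0 lam[OF x0] by (auto simp: lamW_def)
  have f_meas [measurable]: "f \<in> borel_measurable borel"
    unfolding f_def by (rule measurable_kernel_summand[OF lamW_meas])
  have f_nonneg: "0 \<le> f u" for u unfolding f_def by (rule kernel_summand_nonneg[OF \<gamma> h lamW(1)])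
  obtain F where f_bound: "\<And>u. f u \<le> F"
    unfolding f_def using kernel_summand_bound[of \<gamma> "h n" lamW K x0, OF \<gamma> h lamW lamW_x0(2)] by blast
  have S_meas [measurable]: "S \<in> borel_measurable config_space"
    unfolding S_def by (rule measurable_config_sum[OF f_meas W f_nonneg])
  have \<Phi>_meas [measurable]: "\<Phi> i \<in> M \<rightarrow>\<^sub>M config_space" if "i \<ge> 1" for i
    using iid that by (simp add: iid_point_processes_def)
  have m_eq: "m = (LINT u|lborel. indicator W u * (f u * lam u))"
    and A_eq: "A = (LINT u|lborel. indicator W u * ((f u)\<^sup>2 * lam u))"
    unfolding m_def A_def f_def lamW_def by (simp_all add: mult_ac)
  note one = linear_statistic_moments[OF \<Phi>_meas[of 1, OF order_refl] intensity density W lam g G f_meas f_nonneg f_bound,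
      folded m_eq A_eq]
  have S1_sq: "integrable M (\<lambda>\<omega>. (S (\<Phi> 1 \<omega>))\<^sup>2)" unfolding S_def by (rule one(2))
  have S1_ex: "expectation (\<lambda>\<omega>. S (\<Phi> 1 \<omega>)) = m" unfolding S_def by (rule one(3))
  have S1_var: "\<bar>variance (\<lambda>\<omega>. S (\<Phi> 1 \<omega>)) - A\<bar> \<le> (G + 1) * m\<^sup>2" unfolding S_def by (rule one(4))
  have distr: "distr M config_space (\<Phi> i) = distr M config_space (\<Phi> 1)" if "i \<ge> 1" for i
    using iid that unfolding iid_point_processes_def by blast
  have transfer: "expectation (\<lambda>\<omega>. k (\<Phi> i \<omega>)) = expectation (\<lambda>\<omega>. k (\<Phi> 1 \<omega>))"
    if "i \<ge> 1" "k \<in> borel_measurable config_space" for i and k :: "(real ^ 'n) set \<Rightarrow> real"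
    using integral_distr[OF \<Phi>_meas[OF that(1)] that(2)] integral_distr[OF \<Phi>_meas[OF order_refl] that(2)]
      distr[OF that(1)] by simp
  have Si_sq: "integrable M (\<lambda>\<omega>. (S (\<Phi> i \<omega>))\<^sup>2)" if "i \<ge> 1" for i
    using S1_sq integrable_distr_eq[OF \<Phi>_meas[OF that], of "\<lambda>\<phi>. (S \<phi>)\<^sup>2"]
      integrable_distr_eq[OF \<Phi>_meas[OF order_refl], of "\<lambda>\<phi>. (S \<phi>)\<^sup>2"] distr[OF that] by simp
  have Si_ex: "expectation (\<lambda>\<omega>. S (\<Phi> i \<omega>)) = m" if "i \<ge> 1" for i
    using transfer[OF that S_meas] S1_ex by simp
  have Si_var: "variance (\<lambda>\<omega>. S (\<Phi> i \<omega>)) = variance (\<lambda>\<omega>. S (\<Phi> 1 \<omega>))" if "i \<ge> 1" for i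
  proof -
    have "(\<lambda>\<phi>. (S \<phi> - m)\<^sup>2) \<in> borel_measurable config_space" by measurable
    from transfer[OF that this] show ?thesis unfolding Si_ex[OF that] S1_ex .
  qed
  have indep: "indep_vars (\<lambda>_. borel) (\<lambda>i \<omega>. S (\<Phi> i \<omega>)) {1..n}"
  proof (rule indep_vars_compose2[where Y = "\<lambda>_. S"])
    show "indep_vars (\<lambda>_. config_space) \<Phi> {1..n}"
    proof (rule indep_vars_subset)
      show "indep_vars (\<lambda>_. config_space) \<Phi> {1..}"
        using iid unfolding iid_point_processes_def by blast
    qed auto
  qed (use S_meas in auto)
  have est: "adaptive_estimator \<Phi> W lam \<gamma> h x0 n = (\<lambda>\<omega>. 1 / real n * (\<Sum>i=1..n. S (\<Phi> i \<omega>)))"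
  proof
    fix \<omega>
    have "abramson_weight lamW x0 y = abramson_weight lam x0 y" if "y \<in> W" for y
      using that lamW_x0 by (simp add: abramson_weight_def lamW_def)
    thus "adaptive_estimator \<Phi> W lam \<gamma> h x0 n \<omega> = 1 / real n * (\<Sum>i=1..n. S (\<Phi> i \<omega>))"
      unfolding adaptive_estimator_def S_def f_def kernel_summand_def
      by (intro arg_cong2[where f = "(*)"] refl sum.cong) auto
  qed
  note avg = indep_vars_average_moments[OF n indep, of m "variance (\<lambda>\<omega>. S (\<Phi> 1 \<omega>))"]
  show "expectation (adaptive_estimator \<Phi> W lam \<gamma> h x0 n) = m"
    unfolding est by (rule avg(1)[OF Si_sq Si_ex Si_var]) simp_all
  have var: "variance (adaptive_estimator \<Phi> W lam \<gamma> h x0 n) = variance (\<lambda>\<omega>. S (\<Phi> 1 \<omega>)) / real n"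
    unfolding est by (rule avg(2)[OF Si_sq Si_ex Si_var]) simp_all
  have "\<bar>variance (\<lambda>\<omega>. S (\<Phi> 1 \<omega>)) / real n - A / real n\<bar> = \<bar>variance (\<lambda>\<omega>. S (\<Phi> 1 \<omega>)) - A\<bar> / real n"
    by (simp flip: diff_divide_distrib)
  also have "\<dots> \<le> (G + 1) * m\<^sup>2 / real n"
    by (intro divide_right_mono S1_var) simp
  finally show "\<bar>variance (adaptive_estimator \<Phi> W lam \<gamma> h x0 n) - A / real n\<bar> \<le> (G + 1) * m\<^sup>2 / real n"
    unfolding var .
qed

theorem theorem2:
  fixes M :: "'w measure"
    and \<Phi> :: "nat \<Rightarrow> 'w \<Rightarrow> (real ^ 'n::finite) set"
    and W :: "(real ^ 'n) set"
    and lam :: "real ^ 'n \<Rightarrow> real"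
    and \<rho> :: "(real ^ 'n) \<times> (real ^ 'n) \<Rightarrow> real"
    and lam_lo lam_hi \<gamma> :: real
    and h :: "nat \<Rightarrow> real"
    and x0 :: "real ^ 'n"
  assumes "prob_space M"
    and "W \<noteq> {}" "bounded W" "open W"
    and "iid_point_processes M \<Phi>"
    and "locally_finite_moments M (\<Phi> 1)"
    and "is_intensity M (\<Phi> 1) W lam"
    and "is_product_density2 M (\<Phi> 1) W \<rho>"
    and "bounded {pair_correlation lam \<rho> u v | u v. u \<in> W \<and> v \<in> W}"
    and "0 < lam_lo" "lam_lo < lam_hi" "\<And>x. x \<in> W \<Longrightarrow> lam x \<in> {lam_lo<..<lam_hi}"
    and "C2_on W lam"
    and "\<And>i j. bounded (partial_deriv i (partial_deriv j lam) ` W)"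
    and "\<gamma> > 2"
    and "\<And>n. n \<ge> 1 \<Longrightarrow> h n > 0"
    and "h \<longlonglongrightarrow> 0"
    and "filterlim (\<lambda>n. real n * h n ^ CARD('n)) at_top sequentially"
    and "x0 \<in> W"
  shows "(\<lambda>n. bias M (adaptive_estimator \<Phi> W lam \<gamma> h x0 n) (lam x0)) \<in> o(\<lambda>n. (h n)\<^sup>2) \<and>
    (\<lambda>n. prob_space.variance M (adaptive_estimator \<Phi> W lam \<gamma> h x0 n) -
           lam x0 * beta_Q TYPE('n) \<gamma> / (real n * h n ^ CARD('n)))
      \<in> O(\<lambda>n. 1 / (real n * h n ^ (CARD('n) - 1)))"
proof -
  interpret prob_space M by fact
  let ?d = "CARD('n)"
  define est where "est = adaptive_estimator \<Phi> W lam \<gamma> h x0"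
  define K where "K = beta_const TYPE('n) \<gamma>"
  define lamW where "lamW = (\<lambda>u. indicator W u * lam u)"
  define t where "t = (\<lambda>n u. lamW (x0 + h n *\<^sub>R u) / lam x0)"
  define I where "I = (\<lambda>n. LINT u|lborel. profile (?d / 2 + 1) \<gamma> (u \<bullet> u) (t n u))"
  define J where "J = (\<lambda>n. LINT u|lborel. profile (?d + 1) (2 * \<gamma>) (u \<bullet> u) (t n u))"
  define m where "m = (\<lambda>n. LINT y|lborel. kernel_summand lamW \<gamma> x0 (h n) y * lamW y)"
  define A where "A = (\<lambda>n. LINT y|lborel. (kernel_summand lamW \<gamma> x0 (h n) y)\<^sup>2 * lamW y)"
  have \<gamma>: "\<gamma> > 0" using \<open>\<gamma> > 2\<close> by simp
  have K: "K > 0" unfolding K_def by (rule beta_const_pos[OF \<gamma>])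
  have W_borel: "W \<in> sets borel" using \<open>open W\<close> by simp
  have lam_pos: "0 < lam u \<and> lam u \<le> lam_hi" if "u \<in> W" for u
    using assms(12)[OF that] \<open>0 < lam_lo\<close> by auto
  have l0: "lam x0 > 0" using lam_pos \<open>x0 \<in> W\<close> by blast
  have lam_borel: "set_borel_measurable borel W lam"
    using \<open>is_intensity M (\<Phi> 1) W lam\<close> by (simp add: is_intensity_def)
  have lamW: "lamW \<in> borel_measurable borel" "\<And>u. 0 \<le> lamW u" "lamW x0 = lam x0"
    using lam_borel lam_pos \<open>x0 \<in> W\<close>
    by (auto simp: lamW_def set_borel_measurable_def indicator_def less_imp_le)
  obtain G where G: "0 \<le> G" "\<And>u v. u \<in> W \<Longrightarrow> v \<in> W \<Longrightarrow> pair_correlation lam \<rho> u v \<le> G"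
  proof -
    obtain G where "\<And>x. x \<in> {pair_correlation lam \<rho> u v | u v. u \<in> W \<and> v \<in> W} \<Longrightarrow> norm x \<le> G" "G > 0"
      using \<open>bounded {pair_correlation lam \<rho> u v | u v. u \<in> W \<and> v \<in> W}\<close> unfolding bounded_pos by blast
    with that[of G] show ?thesis by (fastforce simp: abs_le_iff)
  qed
  have h_pos: "\<forall>\<^sub>F n in sequentially. h n > 0"
    using eventually_ge_at_top[of 1] by eventually_elim (rule assms(16))
  have h_le_1: "\<forall>\<^sub>F n in sequentially. h n \<le> 1"
    using order_tendstoD(2)[OF \<open>h \<longlonglongrightarrow> 0\<close>, of 1] by (auto elim: eventually_mono)
  obtain R C where dil: "dilation_sequence t h (\<lambda>u. gradient_form lam x0 u / lam x0)
      (\<lambda>u. hessian_form lam x0 u / (2 * lam x0)) (lam_lo / lam x0) (lam_hi / lam x0) R C"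
    using dilation_sequence_intensity[OF \<open>open W\<close> \<open>x0 \<in> W\<close> \<open>C2_on W lam\<close> assms(14) \<open>0 < lam_lo\<close>
        assms(12) lam_borel \<open>h \<longlonglongrightarrow> 0\<close> h_pos]
    unfolding t_def lamW_def by blast
  have I_lim: "(\<lambda>n. I n - K) \<in> o(\<lambda>n. (h n)\<^sup>2)"
    using dilation_sequence.abramson_cancellation[OF dil \<open>\<gamma> > 2\<close>]
    unfolding I_def K_def beta_const_eq[where 'n = 'n, of \<gamma> "?d / 2 + 1"] by simp
  have J_lim: "(\<lambda>n. J n - K\<^sup>2 * beta_Q TYPE('n) \<gamma>) \<in> O(h)"
    using dilation_sequence.profile_integral_perturbation[OF dil, of "2 * \<gamma>" "?d + 1"] \<open>\<gamma> > 2\<close> K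
    unfolding J_def beta_Q_eq[where 'n = 'n, of \<gamma> "?d + 1"] K_def[symmetric] by simp
  have m_eq: "m n = lam x0 / K * I n"
    and A_eq: "A n = lam x0 / (K\<^sup>2 * h n ^ ?d) * J n" if "h n > 0" for n
    using kernel_summand_integrals[of "h n" lamW x0 \<gamma>, OF that lamW(2) _ lamW(1)] l0
    unfolding m_def A_def I_def J_def K_def t_def lamW(3) by auto
  have m_diff: "m n - lam x0 = lam x0 / K * (I n - K)" if "h n > 0" for n
    unfolding m_eq[OF that] using K by (simp add: field_simps)
  have m_lim: "(\<lambda>n. m n - lam x0) \<in> o(\<lambda>n. (h n)\<^sup>2)"
  proof -
    have "(\<lambda>n. lam x0 / K * (I n - K)) \<in> o(\<lambda>n. (h n)\<^sup>2)"
      using I_lim K l0 by (subst landau_o.small.cmult_in_iff) auto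
    moreover have eq: "\<forall>\<^sub>F n in sequentially. m n - lam x0 = lam x0 / K * (I n - K)"
      using h_pos by eventually_elim (rule m_diff)
    ultimately show ?thesis by (simp only: landau_o.small.in_cong[OF eq])
  qed
  have moments: "expectation (est n) = m n"
    "\<bar>variance (est n) - A n / real n\<bar> \<le> (G + 1) * (m n)\<^sup>2 / real n" if "n \<ge> 1" for n
    using adaptive_estimator_moments[where \<Phi> = \<Phi> and lam = lam and h = h and n = n, OF assms(5,7,8) W_borel \<open>bounded W\<close> \<open>x0 \<in> W\<close> lam_pos G(2,1) \<gamma> that
        assms(16)[OF that]]
    unfolding est_def m_def A_def lamW_def by auto
  have bias_eq: "\<forall>\<^sub>F n in sequentially. bias M (est n) (lam x0) = m n - lam x0"
    using eventually_ge_at_top[of 1] by eventually_elim (simp add: bias_def moments(1))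
  have bias: "(\<lambda>n. bias M (est n) (lam x0)) \<in> o(\<lambda>n. (h n)\<^sup>2)"
    using m_lim by (simp only: landau_o.small.in_cong[OF bias_eq])
  have "\<forall>\<^sub>F n in sequentially. norm (m n - lam x0) \<le> 1 * norm ((h n)\<^sup>2)"
    by (rule landau_o.smallD[OF m_lim]) simp
  hence m_bound: "\<forall>\<^sub>F n in sequentially. (m n)\<^sup>2 \<le> (lam x0 + 1)\<^sup>2"
    using h_pos h_le_1
  proof eventually_elim
    case (elim n)
    have "(h n)\<^sup>2 \<le> 1" using elim by (simp add: power_le_one)
    hence "\<bar>m n\<bar> \<le> lam x0 + 1" using elim l0 by simp
    from power_mono[OF this, of 2] show ?case by simp
  qed
  obtain B where B: "B > 0" "\<forall>\<^sub>F n in sequentially. norm (J n - K\<^sup>2 * beta_Q TYPE('n) \<gamma>) \<le> B * norm (h n)"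
    using landau_o.bigE[OF J_lim] by blast
  \<comment> \<open>The first term bounds the part of order 1/n, absorbed because h is eventually at most 1; the second comes from the error O(h) in J.\<close>
  define D where "D = (G + 1) * (lam x0 + 1)\<^sup>2 + lam x0 / K\<^sup>2 * B"
  have "\<forall>\<^sub>F n in sequentially. norm (variance (est n) - lam x0 * beta_Q TYPE('n) \<gamma> / (real n * h n ^ ?d))
      \<le> D * norm (1 / (real n * h n ^ (?d - 1)))"
    using eventually_ge_at_top[of 1] h_pos h_le_1 m_bound B(2)
  proof eventually_elim
    case (elim n)
    have hd: "h n ^ ?d = h n * h n ^ (?d - 1)" by (simp add: power_eq_if)
    have hd': "0 < h n ^ (?d - 1)" "h n ^ (?d - 1) \<le> 1" using elim by (auto intro: power_le_one)
    have n: "real n > 0" using elim by simp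
    have "(G + 1) * (m n)\<^sup>2 / real n \<le> (G + 1) * (lam x0 + 1)\<^sup>2 / real n"
      using elim G by (intro divide_right_mono mult_left_mono) auto
    also have "\<dots> \<le> (G + 1) * (lam x0 + 1)\<^sup>2 / (real n * h n ^ (?d - 1))"
      using n hd' G by (intro divide_left_mono mult_nonneg_nonneg mult_pos_pos) (auto simp: mult_left_le)
    finally have 1: "\<bar>variance (est n) - A n / real n\<bar> \<le> (G + 1) * (lam x0 + 1)\<^sup>2 / (real n * h n ^ (?d - 1))"
      using moments(2)[of n] elim by linarith
    have "A n / real n - lam x0 * beta_Q TYPE('n) \<gamma> / (real n * h n ^ ?d)
        = lam x0 / K\<^sup>2 * (J n - K\<^sup>2 * beta_Q TYPE('n) \<gamma>) / (real n * h n ^ ?d)"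
      unfolding A_eq[OF elim(2)] using elim K n by (simp add: field_simps)
    also have "\<bar>\<dots>\<bar> = lam x0 / K\<^sup>2 * \<bar>J n - K\<^sup>2 * beta_Q TYPE('n) \<gamma>\<bar> / (real n * h n ^ ?d)"
      using elim n l0 by (simp add: abs_mult)
    also have "\<dots> \<le> lam x0 / K\<^sup>2 * (B * h n) / (real n * h n ^ ?d)"
      using elim n l0 by (intro divide_right_mono mult_left_mono) auto
    also have "\<dots> = lam x0 / K\<^sup>2 * B / (real n * h n ^ (?d - 1))"
      unfolding hd using elim by simp
    finally have "\<bar>variance (est n) - lam x0 * beta_Q TYPE('n) \<gamma> / (real n * h n ^ ?d)\<bar>
      \<le> (G + 1) * (lam x0 + 1)\<^sup>2 / (real n * h n ^ (?d - 1)) + lam x0 / K\<^sup>2 * B / (real n * h n ^ (?d - 1))"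
      using 1 by linarith
    also have "\<dots> = D * norm (1 / (real n * h n ^ (?d - 1)))"
      using n hd' unfolding D_def by (simp add: add_divide_distrib)
    finally show ?case by simp
  qed
  hence "(\<lambda>n. variance (est n) - lam x0 * beta_Q TYPE('n) \<gamma> / (real n * h n ^ ?d))
      \<in> O(\<lambda>n. 1 / (real n * h n ^ (?d - 1)))"
    by (rule bigoI)
  with bias show ?thesis unfolding est_def by blast
qed

end
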